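(* Let $\mathcal{G}=(\mathcal{V},\mathcal{E})$ be an undirected graph with $\mathcal{V}=\{1,\dots,N\}$ and neighbor sets $\mathcal{N}_i$, let $f_i:\mathbb{R}^{n(|\mathcal{N}_i|+1)}\to\mathbb{R}\cup\{+\infty\}$, $i\in\mathcal{V}$, be closed, proper and convex, and assume that the problem $$\min_{x_1,\dots,x_N\in\mathbb{R}^n}\ \sum_{i=1}^N f_i\big(x_i,\{x_j\}_{j\in\mathcal{N}_i}\big)$$ has a unique optimal solution $\mathbf{x}^*=(x_1^*,\dots,x_N^* )$. Let $0<\alpha<1$ and $\rho>0$. Then, for any initial conditions, the trajectories $k\mapsto x_i^{(i)}(k)$ and $k\mapsto x_j^{(i)}(k)$, $i\in\mathcal{V}$, $j\in\mathcal{N}_i$, generated by the modified partition-based R-ADMM algorithm (described in the context) satisfy $$\lim_{k\to\infty}x_i^{(i)}(k)=x_i^*,\qquad \lim_{k\to\infty}x_j^{(i)}(k)=x_j^*,\qquad \forall i\in\mathcal{V},\ j\in\mathcal{N}_i .$$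
   Context: The graph has no self-loops, and $\mathcal{N}_i=\{j\in\mathcal{V}:(i,j)\in\mathcal{E}\}$. A function is closed if its sublevel sets are closed; proper has the usual convex-analysis meaning. Modified partition-based R-ADMM algorithm. Each node $i$ keeps $\mathbf{x}^{(i)}=(x_i^{(i)},\{x_j^{(i)}\}_{j\in\mathcal{N}_i})$, all components in $\mathbb{R}^n$ ($x_j^{(i)}$ is node $i$'s copy of $x_j$), and auxiliary variables $z_i^{(j,i)},z_j^{(j,i)}\in\mathbb{R}^n$ for $j\in\mathcal{N}_i$, with arbitrary initial values $z_i^{(j,i)}(0),z_j^{(j,i)}(0)$. At each iteration $k=0,1,2,\dots$, every node $i$: (1) computes $$\mathbf{x}^{(i)}(k)=\arg\min_{x_i^{(i)},\{x_j^{(i)}\}_{j\in\mathcal{N}_i}}\Big\{f_i\big(x_i^{(i)},\{x_j^{(i)}\}_{j\in\mathcal{N}_i}\big)-\Big(\sum_{j\in\mathcal{N}_i}z_i^{(j,i)}(k)\Big)^{\top}x_i^{(i)}-\sum_{j\in\mathcal{N}_i}z_j^{(j,i)}(k)^{\top}x_j^{(i)}+\frac{\rho}{2}|\mathcal{N}_i|\,\|x_i^{(i)}\|^2+\frac{\rho}{2}\sum_{j\in\mathcal{N}_i}\|x_j^{(i)}\|^2\Big\};$$ (2) for all $j\in\mathcal{N}_i$, computes and sends to $j$ the quantities $q_i^{(i\to j)}=-z_i^{(j,i)}(k)+2\rho x_i^{(i)}(k)$ and $q_j^{(i\to j)}=-z_j^{(j,i)}(k)+2\rho x_j^{(i)}(k)$;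 (3) having received $q_j^{(j\to i)}=-z_j^{(i,j)}(k)+2\rho x_j^{(j)}(k)$ and $q_i^{(j\to i)}=-z_i^{(i,j)}(k)+2\rho x_i^{(j)}(k)$ from each $j\in\mathcal{N}_i$, updates $$z_i^{(j,i)}(k+1)=(1-\alpha)z_i^{(j,i)}(k)+\alpha q_i^{(j\to i)},\qquad z_j^{(j,i)}(k+1)=(1-\alpha)z_j^{(j,i)}(k)+\alpha q_j^{(j\to i)}.$$ *)

theory Defs
  imports "HOL-Analysis.Analysis"
begin

text \<open>
  The vertex set is the universe of a finite type \<open>'v\<close>, and an undirected graph without
  self-loops is a symmetric, irreflexive relation \<open>E\<close> on it. The
  space of families of vectors in \<open>real ^ 'n\<close> indexed by a set \<open>S\<close> of vertices (Euclidean
  space of dimension \<open>n * card S\<close>) is the extensional function space \<open>\<Pi>\<^sub>E j\<in>S. UNIV\<close>. The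
  cost function of node \<open>i\<close> lives on the families indexed by the closed neighborhood of \<open>i\<close>;
  its values elsewhere are never used.
\<close>

definition neighbors :: "('v \<times> 'v) set \<Rightarrow> 'v \<Rightarrow> 'v set" where
  "neighbors E i = {j. (i, j) \<in> E}"

definition closed_nbhd :: "('v \<times> 'v) set \<Rightarrow> 'v \<Rightarrow> 'v set" where
  "closed_nbhd E i = insert i (neighbors E i)"

abbreviation families :: "'v set \<Rightarrow> ('v \<Rightarrow> real ^ 'n) set" where
  "families S \<equiv> (\<Pi>\<^sub>E j\<in>S. UNIV)"

definition closed_function :: "'v set \<Rightarrow> (('v \<Rightarrow> real ^ 'n) \<Rightarrow> ereal) \<Rightarrow> bool" where
  "closed_function S f \<longleftrightarrow>
     (\<forall>c::real. closedin (product_topology (\<lambda>_. euclidean) S) {x \<in> families S. f x \<le> ereal c})"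

definition proper_function :: "'v set \<Rightarrow> (('v \<Rightarrow> real ^ 'n) \<Rightarrow> ereal) \<Rightarrow> bool" where
  "proper_function S f \<longleftrightarrow>
     (\<forall>x \<in> families S. f x \<noteq> -\<infinity>) \<and> (\<exists>x \<in> families S. f x \<noteq> \<infinity>)"

definition convex_function :: "'v set \<Rightarrow> (('v \<Rightarrow> real ^ 'n) \<Rightarrow> ereal) \<Rightarrow> bool" where
  "convex_function S f \<longleftrightarrow>
     (\<forall>x \<in> families S. \<forall>y \<in> families S. \<forall>t::real. 0 < t \<and> t < 1 \<longrightarrow>
        f (\<lambda>j\<in>S. (1 - t) *\<^sub>R x j + t *\<^sub>R y j) \<le> ereal (1 - t) * f x + ereal t * f y)"

definition total_cost ::
  "('v::finite \<times> 'v) set \<Rightarrow> ('v \<Rightarrow> ('v \<Rightarrow> real ^ 'n) \<Rightarrow> ereal) \<Rightarrow> ('v \<Rightarrow> real ^ 'n) \<Rightarrow> ereal" where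
  "total_cost E f x = (\<Sum>i\<in>UNIV. f i (restrict x (closed_nbhd E i)))"

definition optimal_solution ::
  "('v::finite \<times> 'v) set \<Rightarrow> ('v \<Rightarrow> ('v \<Rightarrow> real ^ 'n) \<Rightarrow> ereal) \<Rightarrow> ('v \<Rightarrow> real ^ 'n) \<Rightarrow> bool" where
  "optimal_solution E f x \<longleftrightarrow> is_arg_min (total_cost E f) (\<lambda>_. True) x"

text \<open>
  The auxiliary variables are stored as \<open>z c j i\<close> for \<open>z\<^sub>c\<^sup>(\<^sup>j\<^sup>,\<^sup>i\<^sup>)\<close>, held by node \<open>i\<close>, where
  \<open>j\<close> is a neighbor of \<open>i\<close> and \<open>c\<close> is \<open>i\<close> or \<open>j\<close>. Entries with other indices are never
  read by the updates of those entries or of the primal variables.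
\<close>

type_synonym ('v, 'n) aux = "'v \<Rightarrow> 'v \<Rightarrow> 'v \<Rightarrow> real ^ 'n"

definition local_objective ::
  "('v \<times> 'v) set \<Rightarrow> ('v \<Rightarrow> ('v \<Rightarrow> real ^ 'n) \<Rightarrow> ereal) \<Rightarrow> real \<Rightarrow> ('v, 'n) aux \<Rightarrow> 'v
     \<Rightarrow> ('v \<Rightarrow> real ^ 'n) \<Rightarrow> ereal" where
  "local_objective E f \<rho> z i y =
     f i y + ereal
       (- ((\<Sum>j\<in>neighbors E i. z i j i) \<bullet> y i)
        - (\<Sum>j\<in>neighbors E i. z j j i \<bullet> y j)
        + \<rho> / 2 * real (card (neighbors E i)) * (norm (y i))\<^sup>2
        + \<rho> / 2 * (\<Sum>j\<in>neighbors E i. (norm (y j))\<^sup>2))"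

text \<open>
  For convex, closed, proper \<open>f i\<close> and \<open>\<rho> > 0\<close> the local objective is strongly convex if \<open>i\<close>
  has a neighbor, so its minimizer exists and is unique. For an isolated node the objective is
  \<open>f i\<close> itself, whose minimizer is unique as soon as the overall optimal solution is.
\<close>

definition primal_update ::
  "('v \<times> 'v) set \<Rightarrow> ('v \<Rightarrow> ('v \<Rightarrow> real ^ 'n) \<Rightarrow> ereal) \<Rightarrow> real \<Rightarrow> ('v, 'n) aux \<Rightarrow> 'v
     \<Rightarrow> ('v \<Rightarrow> real ^ 'n)" where
  "primal_update E f \<rho> z i =
     arg_min (local_objective E f \<rho> z i) (\<lambda>y. y \<in> families (closed_nbhd E i))"

text \<open>\<open>message E f \<rho> z i j c\<close> is \<open>q\<^sub>c\<^sup>(\<^sup>i\<^sup>\<rightarrow>\<^sup>j\<^sup>)\<close>, the quantity about component \<open>c\<close> sent from \<open>i\<close> to \<open>j\<close>.\<close>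

definition message ::
  "('v \<times> 'v) set \<Rightarrow> ('v \<Rightarrow> ('v \<Rightarrow> real ^ 'n) \<Rightarrow> ereal) \<Rightarrow> real \<Rightarrow> ('v, 'n) aux
     \<Rightarrow> 'v \<Rightarrow> 'v \<Rightarrow> 'v \<Rightarrow> real ^ 'n" where
  "message E f \<rho> z i j c = - z c j i + (2 * \<rho>) *\<^sub>R primal_update E f \<rho> z i c"

definition aux_update ::
  "('v \<times> 'v) set \<Rightarrow> ('v \<Rightarrow> ('v \<Rightarrow> real ^ 'n) \<Rightarrow> ereal) \<Rightarrow> real \<Rightarrow> real \<Rightarrow> ('v, 'n) aux
     \<Rightarrow> ('v, 'n) aux" where
  "aux_update E f \<alpha> \<rho> z =
     (\<lambda>c j i. (1 - \<alpha>) *\<^sub>R z c j i + \<alpha> *\<^sub>R message E f \<rho> z j i c)"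

primrec radmm_aux ::
  "('v \<times> 'v) set \<Rightarrow> ('v \<Rightarrow> ('v \<Rightarrow> real ^ 'n) \<Rightarrow> ereal) \<Rightarrow> real \<Rightarrow> real \<Rightarrow> ('v, 'n) aux
     \<Rightarrow> nat \<Rightarrow> ('v, 'n) aux" where
  "radmm_aux E f \<alpha> \<rho> z0 0 = z0"
| "radmm_aux E f \<alpha> \<rho> z0 (Suc k) = aux_update E f \<alpha> \<rho> (radmm_aux E f \<alpha> \<rho> z0 k)"

text \<open>\<open>radmm_primal E f \<alpha> \<rho> z0 k i j\<close> is node \<open>i\<close>'s copy of \<open>x\<^sub>j\<close> at iteration \<open>k\<close>.\<close>

definition radmm_primal ::
  "('v \<times> 'v) set \<Rightarrow> ('v \<Rightarrow> ('v \<Rightarrow> real ^ 'n) \<Rightarrow> ereal) \<Rightarrow> real \<Rightarrow> real \<Rightarrow> ('v, 'n) aux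
     \<Rightarrow> nat \<Rightarrow> 'v \<Rightarrow> 'v \<Rightarrow> real ^ 'n" where
  "radmm_primal E f \<alpha> \<rho> z0 k i = primal_update E f \<rho> (radmm_aux E f \<alpha> \<rho> z0 k) i"

end

theory Submission imports Defs begin

text \<open>
  Stack all copies held at the two ends of all edges into one vector \<open>w\<close>, let \<open>g w\<close> be the sum
  of the node costs and let the involution \<open>P\<close> exchange the entries of the two ends of each edge. The
  problem is to minimize \<open>g w\<close> subject to \<open>P w = w\<close>, and with \<open>s = z / \<rho>\<close> the algorithm is the
  relaxed Peaceman-Rachford iteration \<open>s' = (1 - \<alpha>) s + \<alpha> P (2 w - s) = s - 2 \<alpha> F\<close>, where
  \<open>w = prox s\<close> is the proximal point of \<open>g / \<rho>\<close>. A node without neighbors takes no part in this;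
  it solves its own problem exactly in every step.

  The textbook argument measures the distance of \<open>s\<close> to a fixed point, that is, to a primal-dual
  solution. Without a constraint qualification no multiplier need exist, and then \<open>s\<close> is
  unbounded. Uniqueness of the primal solution \<open>ws\<close> rescues convergence as follows.

  \<^item> By compactness and convexity, outside each ball around \<open>ws\<close> the violation of \<open>P w = w\<close> or the
    excess cost grows at least linearly (\<open>sharp_growth\<close>). Hence there is no duality gap, and
    multipliers that are optimal up to \<open>\<gamma>\<close> exist for every \<open>\<gamma> > 0\<close> (\<open>approximate_dual\<close>).

  \<^item> Measuring the distance to such approximate solutions shows that \<open>F k\<close> tends to \<open>0\<close> and that
    \<open>norm (s k)\<close> is of smaller order than \<open>sqrt k\<close> (\<open>residual_small\<close>, \<open>state_growth\<close>).

  \<^item> The excess cost of \<open>w k\<close> is at most \<open>\<theta> k = norm (F k) * norm (s k - ws)\<close>. So, again by the growth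
    property, convergence follows once \<open>norm (F k)\<close> is known to be of order \<open>1 / sqrt k\<close>.

  \<^item> For this rate (\<open>residual_rate\<close>), split \<open>F k\<close> into its part \<open>a k\<close> in the fixed space of \<open>P\<close> and its
    part \<open>e k\<close> orthogonal to it. The iteration descends in the first and ascends in the second
    variable of a saddle function, so the value \<open>L k\<close> of that function increases at least by a weighted difference
    of \<open>norm (e k)\<^sup>2\<close> and \<open>norm (a k)\<^sup>2\<close>. As the growth of \<open>L\<close> is limited, sums of the
    squares of \<open>e\<close> are controlled by those of the squares of \<open>a\<close>. But \<open>2 \<alpha> a k\<close> is the decrement of the consensus part of
    \<open>s k\<close>, which unlike \<open>s k\<close> itself is controlled by the primal iterates; summation by parts and
    the summability of the squared differences of \<open>F\<close> bound the squares of \<open>a\<close> over the window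
    from \<open>K / 2\<close> to \<open>K\<close>. The result is a self-improving inequality for \<open>sqrt k * norm (F k)\<close>.
\<close>

section \<open>Convex minimization over the fixed space of a symmetric involution\<close>

text \<open>
  The cost enters through its epigraph, so that infinite values need no arithmetic.
\<close>

locale consensus_problem =
  fixes P :: "'a::euclidean_space \<Rightarrow> 'a" and Epi :: "('a \<times> real) set" and ws :: 'a and p :: real
  assumes linear_P: "linear P"
    and P_P: "\<And>x. P (P x) = x"
    and P_sym: "\<And>x y. P x \<bullet> y = x \<bullet> P y"
    and closed_Epi: "closed Epi"
    and convex_Epi: "convex Epi"
    and Epi_up: "\<And>u t t'. (u, t) \<in> Epi \<Longrightarrow> t \<le> t' \<Longrightarrow> (u, t') \<in> Epi"
    and opt_mem: "(ws, p) \<in> Epi"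
    and P_ws: "P ws = ws"
    and opt_le: "\<And>u t. (u, t) \<in> Epi \<Longrightarrow> P u = u \<Longrightarrow> p \<le> t"
    and opt_unique: "\<And>u. (u, p) \<in> Epi \<Longrightarrow> P u = u \<Longrightarrow> u = ws"
begin

text \<open>
  The orthogonal projections onto the fixed space of \<open>P\<close> (consensus) and onto its orthogonal complement
  (disagreement).
\<close>
definition Cp :: "'a \<Rightarrow> 'a" where "Cp x = (1/2) *\<^sub>R (x + P x)"
definition Dp :: "'a \<Rightarrow> 'a" where "Dp x = (1/2) *\<^sub>R (x - P x)"

lemmas P_linear_simps = linear_add[OF linear_P] linear_diff[OF linear_P] linear_scale[OF linear_P]

lemma linear_Cp: "linear Cp"
  by (rule linearI) (auto simp: Cp_def P_linear_simps algebra_simps)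

lemma linear_Dp: "linear Dp"
  by (rule linearI) (auto simp: Dp_def P_linear_simps algebra_simps)

lemmas Cp_simps = linear_add[OF linear_Cp] linear_diff[OF linear_Cp] linear_scale[OF linear_Cp]
lemmas Dp_simps = linear_add[OF linear_Dp] linear_diff[OF linear_Dp] linear_scale[OF linear_Dp]

lemma Cp_plus_Dp: "Cp x + Dp x = x"
  by (simp add: Cp_def Dp_def flip: scaleR_add_right)

lemma Cp_minus_Dp: "Cp x - Dp x = P x"
  by (simp add: Cp_def Dp_def flip: scaleR_diff_right)

lemma Cp_orth_Dp: "Cp x \<bullet> Dp y = 0"
  by (simp add: Cp_def Dp_def inner_simps P_sym P_P)

lemma inner_split: "x \<bullet> y = Cp x \<bullet> Cp y + Dp x \<bullet> Dp y"
proof -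
  have "x \<bullet> y = (Cp x + Dp x) \<bullet> (Cp y + Dp y)" by (simp add: Cp_plus_Dp)
  then show ?thesis
    using Cp_orth_Dp[of x y] Cp_orth_Dp[of y x] by (simp add: inner_simps inner_commute)
qed

lemma norm_split: "(norm (Cp x))\<^sup>2 + (norm (Dp x))\<^sup>2 = (norm x)\<^sup>2"
  using inner_split[of x x] by (simp add: power2_norm_eq_inner)

lemma norm_Cp_le: "norm (Cp x) \<le> norm x"
  by (rule power2_le_imp_le) (use norm_split[of x] zero_le_power2[of "norm (Dp x)"] in linarith, simp)

lemma norm_Dp_le: "norm (Dp x) \<le> norm x"
  by (rule power2_le_imp_le) (use norm_split[of x] zero_le_power2[of "norm (Cp x)"] in linarith, simp)

lemma norm_P: "norm (P x) = norm x"
  by (simp add: norm_eq_sqrt_inner P_sym P_P)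

lemma Dp_ws: "Dp ws = 0" and Cp_ws: "Cp ws = ws"
  by (simp_all add: Dp_def Cp_def P_ws flip: scaleR_2)

lemma P_Dp: "P (Dp x) = - Dp x"
  by (simp add: Dp_def P_linear_simps P_P algebra_simps)

lemma Dp_Dp: "Dp (Dp x) = Dp x"
proof -
  have "Dp (Dp x) = (1/2) *\<^sub>R (Dp x - P (Dp x))" by (rule Dp_def)
  also have "\<dots> = Dp x" by (simp add: P_Dp)
  finally show ?thesis .
qed

lemma Cp_Dp: "Cp (Dp x) = 0"
  using Cp_plus_Dp[of "Dp x"] by (simp add: Dp_Dp)

lemma Dp_Cp: "Dp (Cp x) = 0"
  using Dp_simps(1)[of "Cp x" "Dp x"] by (simp add: Cp_plus_Dp Dp_Dp)

lemma Cp_Cp: "Cp (Cp x) = Cp x"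
  using Cp_plus_Dp[of "Cp x"] by (simp add: Dp_Cp)

lemma Dp_sym: "Dp x \<bullet> y = x \<bullet> Dp y"
  by (simp add: Dp_def inner_simps P_sym)

lemma fix_P_iff: "P x = x \<longleftrightarrow> Dp x = 0"
  by (auto simp: Dp_def)

lemma continuous_Dp: "(X \<longlongrightarrow> l) F \<Longrightarrow> ((\<lambda>n. Dp (X n)) \<longlongrightarrow> Dp l) F"
  by (rule bounded_linear.tendsto[OF linear_conv_bounded_linear[THEN iffD1, OF linear_Dp]])

lemma limit_in_Epi:
  assumes mem: "\<And>n::nat. (u n, t n) \<in> Epi" and bdd: "\<And>n. norm (u n - ws) \<le> B"
    and "t \<longlonglongrightarrow> l" and "(\<lambda>n. Dp (u n)) \<longlonglongrightarrow> 0"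
  shows "\<exists>m \<phi>. strict_mono (\<phi>::nat \<Rightarrow> nat) \<and> (u \<circ> \<phi>) \<longlonglongrightarrow> m \<and> (m, l) \<in> Epi \<and> P m = m"
proof -
  have "compact (cball ws B)" by simp
  moreover have "\<forall>n. u n \<in> cball ws B" using bdd by (simp add: dist_norm norm_minus_commute)
  ultimately obtain m \<phi> where \<phi>: "strict_mono (\<phi>::nat \<Rightarrow> nat)" and m: "(u \<circ> \<phi>) \<longlonglongrightarrow> m"
    unfolding compact_def by blast
  have lim: "(\<lambda>n. ((u \<circ> \<phi>) n, (t \<circ> \<phi>) n)) \<longlonglongrightarrow> (m, l)"
    by (intro tendsto_Pair m LIMSEQ_subseq_LIMSEQ[OF assms(3) \<phi>])
  have "(m, l) \<in> Epi"
    by (rule closed_sequentially[where f = "\<lambda>n. ((u \<circ> \<phi>) n, (t \<circ> \<phi>) n)", OF closed_Epi _ lim])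
      (simp add: mem)
  have "(\<lambda>n. Dp ((u \<circ> \<phi>) n)) \<longlonglongrightarrow> Dp m" by (rule continuous_Dp[OF m])
  moreover have "(\<lambda>n. Dp ((u \<circ> \<phi>) n)) \<longlonglongrightarrow> 0"
    using LIMSEQ_subseq_LIMSEQ[OF assms(4) \<phi>] by (simp add: o_def)
  ultimately have "P m = m" using LIMSEQ_unique fix_P_iff by blast
  then show ?thesis using \<phi> m \<open>(m, l) \<in> Epi\<close> by (intro exI conjI)
qed

text \<open>
  If the growth failed, there would be points far from \<open>ws\<close> whose disagreement and excess cost are
  negligible relative to their distance. Convex combination with \<open>ws\<close> pulls them back to the sphere of radius
  \<open>\<delta>\<close>, where by compactness they accumulate at a second minimizer.
\<close>
lemma sharp_growth:
  assumes "0 < \<delta>"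
  shows "\<exists>\<eta>>0. \<forall>u t. (u, t) \<in> Epi \<longrightarrow> \<delta> \<le> norm (u - ws) \<longrightarrow>
           \<eta> * norm (u - ws) < norm (Dp u) \<or> \<eta> * norm (u - ws) < t - p"
proof (rule ccontr)
  assume neg: "\<not> ?thesis"
  have *: "\<exists>u t. (u, t) \<in> Epi \<and> \<delta> \<le> norm (u - ws) \<and>
      norm (Dp u) \<le> \<eta> * norm (u - ws) \<and> t - p \<le> \<eta> * norm (u - ws)" if "0 < \<eta>" for \<eta>
  proof -
    from that neg have "\<not> (\<forall>u t. (u, t) \<in> Epi \<longrightarrow> \<delta> \<le> norm (u - ws) \<longrightarrow>
           \<eta> * norm (u - ws) < norm (Dp u) \<or> \<eta> * norm (u - ws) < t - p)" by blast
    then show ?thesis by (simp only: not_all not_imp not_less de_Morgan_disj)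
  qed
  have "\<exists>u t. (u, t) \<in> Epi \<and> \<delta> \<le> norm (u - ws) \<and>
      norm (Dp u) \<le> inverse (real (Suc n)) * norm (u - ws) \<and> t - p \<le> inverse (real (Suc n)) * norm (u - ws)" for n
    by (rule *) simp
  then obtain u t where mem: "\<And>n. (u n, t n) \<in> Epi" and far: "\<And>n. \<delta> \<le> norm (u n - ws)"
    and small: "\<And>n. norm (Dp (u n)) \<le> inverse (real (Suc n)) * norm (u n - ws)"
      "\<And>n. t n - p \<le> inverse (real (Suc n)) * norm (u n - ws)"
    by metis
  define \<theta> where "\<theta> n = \<delta> / norm (u n - ws)" for n
  have pos: "0 < norm (u n - ws)" for n using far[of n] assms by linarith
  have \<theta>: "0 < \<theta> n" "\<theta> n \<le> 1" "\<theta> n * norm (u n - ws) = \<delta>" for n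
    using far[of n] pos[of n] assms by (auto simp: \<theta>_def field_simps)
  define y where "y n = ws + \<theta> n *\<^sub>R (u n - ws)" for n
  have ny: "norm (y n - ws) = \<delta>" for n using \<theta>[of n] by (simp add: y_def)
  have bound: "norm (Dp (y n)) \<le> \<delta> * inverse (real (Suc n))" for n
  proof -
    have "norm (Dp (y n)) = \<theta> n * norm (Dp (u n))"
      using \<theta>(1)[of n] by (simp add: y_def Dp_simps Dp_ws)
    also have "\<dots> \<le> \<theta> n * (inverse (real (Suc n)) * norm (u n - ws))"
      by (rule mult_left_mono[OF small(1)]) (use \<theta>(1)[of n] in simp)
    also have "\<dots> = \<delta> * inverse (real (Suc n))" using \<theta>(3)[of n] by (metis mult.assoc mult.commute)
    finally show ?thesis .
  qed
  have memy: "(y n, p + \<delta> * inverse (real (Suc n))) \<in> Epi" for n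
  proof -
    have "(1 - \<theta> n) *\<^sub>R (ws, p) + \<theta> n *\<^sub>R (u n, t n) \<in> Epi"
      using convexD_alt[OF convex_Epi opt_mem mem[of n]] \<theta>[of n] by simp
    then have 1: "(y n, p + \<theta> n * (t n - p)) \<in> Epi"
      by (simp add: y_def algebra_simps)
    have "\<theta> n * (t n - p) \<le> \<theta> n * (inverse (real (Suc n)) * norm (u n - ws))"
      by (rule mult_left_mono[OF small(2)]) (use \<theta>(1)[of n] in simp)
    also have "\<dots> = \<delta> * inverse (real (Suc n))" using \<theta>(3)[of n] by (metis mult.assoc mult.commute)
    finally show ?thesis using Epi_up[OF 1] by simp
  qed
  have lim0: "(\<lambda>n. \<delta> * inverse (real (Suc n))) \<longlonglongrightarrow> 0"
    using tendsto_mult_right_zero[OF LIMSEQ_inverse_real_of_nat] .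
  have "(\<lambda>n. p + \<delta> * inverse (real (Suc n))) \<longlonglongrightarrow> p"
    using tendsto_add[OF tendsto_const lim0] by simp
  moreover have "(\<lambda>n. Dp (y n)) \<longlonglongrightarrow> 0"
    by (rule Lim_null_comparison[OF _ lim0]) (use bound in simp)
  ultimately obtain m \<phi> where \<phi>: "(y \<circ> \<phi>) \<longlonglongrightarrow> m" and m: "(m, p) \<in> Epi" "P m = m"
    using limit_in_Epi[of y "\<lambda>n. p + \<delta> * inverse (real (Suc n))" \<delta> p, OF memy] ny by auto
  have "m = ws" by (rule opt_unique[OF m])
  moreover have "(\<lambda>n. norm ((y \<circ> \<phi>) n - ws)) \<longlonglongrightarrow> norm (m - ws)"
    by (intro tendsto_intros \<phi>)
  ultimately have "(\<lambda>n. \<delta>) \<longlonglongrightarrow> 0" by (simp add: ny)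
  then show False using assms by (simp add: LIMSEQ_const_iff)
qed

text \<open>
  This is lower semicontinuity, at zero disagreement, of the optimal value as a function of the
  prescribed disagreement; it is the form in which the growth property excludes a duality gap.
\<close>
lemma value_lsc_at_consensus:
  assumes "0 < \<epsilon>"
  shows "\<exists>\<eta>>0. \<forall>u t. (u, t) \<in> Epi \<longrightarrow> norm (Dp u) \<le> \<eta> \<longrightarrow> p - \<epsilon> \<le> t"
proof (rule ccontr)
  assume neg: "\<not> ?thesis"
  obtain \<eta> where "0 < \<eta>" and \<eta>: "\<And>u t. (u, t) \<in> Epi \<Longrightarrow> 1 \<le> norm (u - ws) \<Longrightarrow>
           \<eta> * norm (u - ws) < norm (Dp u) \<or> \<eta> * norm (u - ws) < t - p"
    using sharp_growth[of 1] by auto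
  have "\<exists>u t. (u, t) \<in> Epi \<and> norm (Dp u) \<le> \<eta> * inverse (real (Suc n)) \<and> t < p - \<epsilon>" for n
  proof -
    have "0 < \<eta> * inverse (real (Suc n))" using \<open>0 < \<eta>\<close> by simp
    then have "\<not> (\<forall>u t. (u, t) \<in> Epi \<longrightarrow> norm (Dp u) \<le> \<eta> * inverse (real (Suc n)) \<longrightarrow> p - \<epsilon> \<le> t)"
      using neg by blast
    then show ?thesis by (simp only: not_all not_imp not_le)
  qed
  then obtain u t where mem: "\<And>n. (u n, t n) \<in> Epi" and D: "\<And>n. norm (Dp (u n)) \<le> \<eta> * inverse (real (Suc n))"
    and t: "\<And>n. t n < p - \<epsilon>" by metis
  have near: "norm (u n - ws) \<le> 1" for n
  proof (rule ccontr)
    assume "\<not> ?thesis"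
    then have far: "1 \<le> norm (u n - ws)" by simp
    have "\<eta> * inverse (real (Suc n)) \<le> \<eta> * norm (u n - ws)"
      using \<open>0 < \<eta>\<close> far by (intro mult_left_mono order_trans[OF _ far]) (auto simp: field_simps)
    moreover have "0 < \<eta> * norm (u n - ws)" using \<open>0 < \<eta>\<close> far by (intro mult_pos_pos) auto
    ultimately show False
      using \<eta>[OF mem far] D[of n] t[of n] assms by linarith
  qed
  have "(\<lambda>n. Dp (u n)) \<longlonglongrightarrow> 0"
    by (rule Lim_null_comparison[OF _ tendsto_mult_right_zero[OF LIMSEQ_inverse_real_of_nat, of \<eta>]])
      (use D in simp)
  moreover have mem': "(u n, p - \<epsilon>) \<in> Epi" for n
    by (rule Epi_up[OF mem]) (use t[of n] in simp)
  ultimately obtain m where "(m, p - \<epsilon>) \<in> Epi" "P m = m"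
    using limit_in_Epi[of u "\<lambda>_. p - \<epsilon>" 1 "p - \<epsilon>", OF mem' near tendsto_const] by metis
  then have "p \<le> p - \<epsilon>" by (rule opt_le)
  then show False using assms by simp
qed

text \<open>
  A multiplier \<open>v\<close> that is optimal up to \<open>\<gamma>\<close> is read off a hyperplane that separates \<open>(0, p - \<gamma>)\<close>
  from the pairs of disagreement and cost. The hyperplane is not vertical because \<open>(0, p)\<close> is
  such a pair. The limit case \<open>\<gamma> = 0\<close> is false in general.
\<close>
lemma approximate_dual:
  assumes "0 < \<gamma>"
  shows "\<exists>v. Dp v = v \<and> (\<forall>u t. (u, t) \<in> Epi \<longrightarrow> p - \<gamma> \<le> t - v \<bullet> u)"
proof -
  define S where "S = (\<lambda>(u, t). (Dp u, t)) ` Epi"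
  have "linear (\<lambda>(u, t::real). (Dp u, t))"
    by (rule linearI) (auto simp: Dp_simps)
  then have "convex (closure S)"
    unfolding S_def by (intro convex_closure convex_linear_image convex_Epi)
  moreover have "(0, p - \<gamma>) \<notin> closure S"
  proof
    assume cl: "(0, p - \<gamma>) \<in> closure S"
    obtain \<eta> where "0 < \<eta>" and \<eta>: "\<And>u t. (u, t) \<in> Epi \<Longrightarrow> norm (Dp u) \<le> \<eta> \<Longrightarrow> p - \<gamma>/2 \<le> t"
      using value_lsc_at_consensus[of "\<gamma>/2"] assms by auto
    have "0 < min \<eta> (\<gamma>/2)" using \<open>0 < \<eta>\<close> assms by simp
    then obtain u t where ut: "(u, t) \<in> Epi" "dist (Dp u, t) (0, p - \<gamma>) < min \<eta> (\<gamma>/2)"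
      using cl unfolding closure_approachable S_def by fastforce
    have "dist (Dp u) 0 \<le> dist (Dp u, t) (0, p - \<gamma>)" "dist t (p - \<gamma>) \<le> dist (Dp u, t) (0, p - \<gamma>)"
      using dist_fst_le[of "(Dp u, t)" "(0, p - \<gamma>)"] dist_snd_le[of "(Dp u, t)" "(0, p - \<gamma>)"] by simp_all
    then have "norm (Dp u) \<le> \<eta>" "\<bar>t - (p - \<gamma>)\<bar> < \<gamma>/2" using ut(2) by (auto simp: dist_real_def)
    then show False using \<eta>[OF ut(1)] by linarith
  qed
  ultimately obtain a b where sep: "a \<bullet> (0, p - \<gamma>) < b" "\<And>x. x \<in> closure S \<Longrightarrow> b < a \<bullet> x"
    using separating_hyperplane_closed_point[of "closure S"] by blast
  obtain a1 a2 where a: "a = (a1, a2)" by force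
  have b: "a2 * (p - \<gamma>) < b" using sep(1) by (simp add: a)
  have le: "b < a1 \<bullet> Dp u + a2 * t" if "(u, t) \<in> Epi" for u t
  proof -
    have "(Dp u, t) \<in> closure S" using that closure_subset unfolding S_def by force
    then show ?thesis using sep(2)[of "(Dp u, t)"] by (simp add: a)
  qed
  have "0 < a2 * \<gamma>" using le[OF opt_mem] b by (simp add: Dp_ws algebra_simps)
  then have "0 < a2" using assms by (simp add: zero_less_mult_iff)
  define v where "v = (- (1 / a2)) *\<^sub>R Dp a1"
  have "p - \<gamma> \<le> t - v \<bullet> u" if "(u, t) \<in> Epi" for u t
  proof -
    have "a2 * (v \<bullet> u) = - (a1 \<bullet> Dp u)" using \<open>0 < a2\<close> by (simp add: v_def Dp_sym)
    moreover have "a2 * (p - \<gamma>) < a1 \<bullet> Dp u + a2 * t" using le[OF that] b by linarith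
    ultimately have "a2 * (p - \<gamma>) \<le> a2 * (t - v \<bullet> u)" by (simp add: right_diff_distrib)
    then show ?thesis using \<open>0 < a2\<close> by simp
  qed
  then have "Dp v = v \<and> (\<forall>u t. (u, t) \<in> Epi \<longrightarrow> p - \<gamma> \<le> t - v \<bullet> u)"
    by (simp only: v_def Dp_simps Dp_Dp simp_thms) simp
  then show ?thesis by (rule exI)
qed

definition is_prox :: "'a \<Rightarrow> 'a \<Rightarrow> real \<Rightarrow> bool" where
  "is_prox s w r \<longleftrightarrow> (w, r) \<in> Epi \<and>
     (\<forall>u t. (u, t) \<in> Epi \<longrightarrow> r + (norm (w - s))\<^sup>2 / 2 \<le> t + (norm (u - s))\<^sup>2 / 2)"

text \<open>
  An approximate multiplier provides an affine minorant of the cost, which makes the proximal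
  objective coercive.
\<close>
lemma prox_exists: "\<exists>w r. is_prox s w r"
proof -
  obtain v where v: "\<And>u t. (u, t) \<in> Epi \<Longrightarrow> p - 1 \<le> t - v \<bullet> u"
    using approximate_dual[of 1] by auto
  define \<Phi> where "\<Phi> = (\<lambda>x::'a \<times> real. snd x + (norm (fst x - s))\<^sup>2 / 2)"
  have cont: "continuous_on A \<Phi>" for A unfolding \<Phi>_def by (intro continuous_intros) auto
  define S where "S = Epi \<inter> {x. \<Phi> x \<le> \<Phi> (ws, p)}"
  define B where "B = 2 * (\<Phi> (ws, p) - (p - 1) - v \<bullet> s + (norm v)\<^sup>2 / 2)"
  have uB: "norm (u - (s - v)) \<le> sqrt B" if "(u, t) \<in> S" for u t
  proof -
    have "p - 1 + v \<bullet> u + (norm (u - s))\<^sup>2 / 2 \<le> \<Phi> (ws, p)"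
      using that v[of u t] by (auto simp: S_def \<Phi>_def)
    moreover have "v \<bullet> u + (norm (u - s))\<^sup>2 / 2 = (norm (u - (s - v)))\<^sup>2 / 2 + v \<bullet> s - (norm v)\<^sup>2 / 2"
      by (simp add: power2_norm_eq_inner inner_simps inner_commute field_simps)
    ultimately have "(norm (u - (s - v)))\<^sup>2 \<le> B" by (simp add: B_def algebra_simps)
    then show ?thesis using real_le_rsqrt by blast
  qed
  have "S \<subseteq> cball (s - v) (sqrt B) \<times> {p - 1 - norm v * (norm (s - v) + sqrt B) .. \<Phi> (ws, p)}"
  proof clarify
    fix u t assume ut: "(u, t) \<in> S"
    have "norm u \<le> norm (s - v) + sqrt B"
      using uB[OF ut] norm_triangle_sub[of u "s - v"] by linarith
    then have "norm v * norm u \<le> norm v * (norm (s - v) + sqrt B)" by (intro mult_left_mono) auto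
    moreover have "- (norm v * norm u) \<le> v \<bullet> u"
      using Cauchy_Schwarz_ineq2[of v u] by linarith
    moreover have "p - 1 \<le> t - v \<bullet> u" using v ut by (simp add: S_def)
    moreover have "t \<le> \<Phi> (u, t)" by (simp add: \<Phi>_def)
    moreover have "\<Phi> (u, t) \<le> \<Phi> (ws, p)" using ut by (simp add: S_def)
    ultimately show "u \<in> cball (s - v) (sqrt B) \<and> t \<in> {p - 1 - norm v * (norm (s - v) + sqrt B) .. \<Phi> (ws, p)}"
      using uB[OF ut] by (simp add: dist_norm norm_minus_commute)
  qed
  then have "bounded S"
    by (rule bounded_subset[OF bounded_Times[OF bounded_cball bounded_closed_interval]])
  moreover have "closed S"
    unfolding S_def by (rule closed_Int[OF closed_Epi closed_Collect_le[OF cont continuous_on_const]])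
  ultimately have "compact S" by (simp add: compact_eq_bounded_closed)
  moreover have "(ws, p) \<in> S" using opt_mem by (simp add: S_def)
  ultimately have "\<exists>x\<in>S. \<forall>y\<in>S. \<Phi> x \<le> \<Phi> y"
    by (intro continuous_attains_inf cont) auto
  then obtain x where x: "x \<in> S" "\<And>y. y \<in> S \<Longrightarrow> \<Phi> x \<le> \<Phi> y" by auto
  have "\<Phi> x \<le> \<Phi> y" if "y \<in> Epi" for y
    using x that by (cases "\<Phi> y \<le> \<Phi> (ws, p)") (auto simp: S_def)
  moreover have "x \<in> Epi" using x by (simp add: S_def)
  ultimately have "is_prox s (fst x) (snd x)" by (simp add: is_prox_def \<Phi>_def del: split_paired_All) force
  then show ?thesis by (intro exI)
qed

lemma prox_subgradient:
  assumes "is_prox s w r" and ut: "(u, t) \<in> Epi"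
  shows "r + (s - w) \<bullet> (u - w) \<le> t"
proof -
  have wr: "(w, r) \<in> Epi" and min: "\<And>u t. (u, t) \<in> Epi \<Longrightarrow> r + (norm (w - s))\<^sup>2 / 2 \<le> t + (norm (u - s))\<^sup>2 / 2"
    using assms(1) by (auto simp: is_prox_def)
  define N where "N = (norm (u - w))\<^sup>2 / 2"
  have *: "r + (s - w) \<bullet> (u - w) - t \<le> \<theta> * N" if "0 < \<theta>" "\<theta> < 1" for \<theta>
  proof -
    have "(1 - \<theta>) *\<^sub>R (w, r) + \<theta> *\<^sub>R (u, t) \<in> Epi"
      using convexD_alt[OF convex_Epi wr ut] that by simp
    then have "(w + \<theta> *\<^sub>R (u - w), r + \<theta> * (t - r)) \<in> Epi" by (simp add: algebra_simps)
    from min[OF this]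
    have "(norm (w - s))\<^sup>2 / 2 \<le> \<theta> * (t - r) + (norm ((w - s) + \<theta> *\<^sub>R (u - w)))\<^sup>2 / 2"
      by (simp add: add_diff_eq add.commute diff_add_eq)
    also have "(norm ((w - s) + \<theta> *\<^sub>R (u - w)))\<^sup>2 = (norm (w - s))\<^sup>2 + 2 * \<theta> * ((w - s) \<bullet> (u - w)) + \<theta>\<^sup>2 * (norm (u - w))\<^sup>2"
      by (simp only: power2_norm_eq_inner inner_add inner_scaleR_left inner_scaleR_right)
        (simp add: inner_commute power2_eq_square algebra_simps)
    finally have "0 \<le> \<theta> * (t - r + (w - s) \<bullet> (u - w) + \<theta> * N)"
      by (simp add: N_def power2_eq_square field_simps)
    then have "0 \<le> t - r + (w - s) \<bullet> (u - w) + \<theta> * N" using that(1) by (simp add: zero_le_mult_iff)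
    moreover have "(w - s) \<bullet> (u - w) = - ((s - w) \<bullet> (u - w))" by (simp add: inner_diff_left)
    ultimately show ?thesis by linarith
  qed
  have "0 \<le> N" by (simp add: N_def)
  have "r + (s - w) \<bullet> (u - w) - t \<le> 0"
  proof (rule field_le_epsilon)
    fix e :: real assume "0 < e"
    define \<theta> where "\<theta> = min (1/2) (e / (N + 1))"
    have "\<theta> * N \<le> (e / (N + 1)) * N" using \<open>0 \<le> N\<close> by (intro mult_right_mono) (auto simp: \<theta>_def)
    also have "\<dots> \<le> e" using \<open>0 \<le> N\<close> \<open>0 < e\<close> by (simp add: field_simps)
    finally have "\<theta> * N \<le> e" .
    moreover have "0 < \<theta>" "\<theta> < 1" using \<open>0 < e\<close> \<open>0 \<le> N\<close> by (simp_all add: \<theta>_def min_def)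
    ultimately show "r + (s - w) \<bullet> (u - w) - t \<le> 0 + e" using *[of \<theta>] by linarith
  qed
  then show ?thesis by simp
qed

end


section \<open>The relaxed Peaceman-Rachford iteration\<close>

text \<open>Each \<open>w k\<close> is the proximal point of \<open>s k\<close>, and \<open>r k\<close> is its cost.\<close>

locale relaxed_splitting = consensus_problem P Epi ws p
  for P :: "'a::euclidean_space \<Rightarrow> 'a" and Epi ws p +
  fixes \<alpha> :: real and s w :: "nat \<Rightarrow> 'a" and r :: "nat \<Rightarrow> real"
  assumes \<alpha>_pos: "0 < \<alpha>" and \<alpha>_less: "\<alpha> < 1"
    and prox: "\<And>k. is_prox (s k) (w k) (r k)"
    and step: "\<And>k. s (Suc k) = (1 - \<alpha>) *\<^sub>R s k + \<alpha> *\<^sub>R P (2 *\<^sub>R w k - s k)"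
begin

text \<open>
  The step is \<open>s (Suc k) = s k - 2 \<alpha> F k\<close>. The residual \<open>F k\<close> vanishes iff \<open>s k\<close> is a fixed point
  of the iteration; \<open>a k\<close> and \<open>e k\<close> are its consensus and disagreement parts.
\<close>
definition F :: "nat \<Rightarrow> 'a" where "F k = (1/2) *\<^sub>R (s k - P (2 *\<^sub>R w k - s k))"
definition a :: "nat \<Rightarrow> 'a" where "a k = Cp (s k - w k)"
definition e :: "nat \<Rightarrow> 'a" where "e k = Dp (w k)"

lemma mem: "(w k, r k) \<in> Epi"
  using prox by (simp add: is_prox_def)

lemma subgradient: "(u, t) \<in> Epi \<Longrightarrow> r k + (s k - w k) \<bullet> (u - w k) \<le> t"
  by (rule prox_subgradient[OF prox])

lemma step_F: "s (Suc k) = s k - (2 * \<alpha>) *\<^sub>R F k"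
  by (simp add: step F_def algebra_simps)

lemma F_eq: "F k = a k + e k"
proof -
  have "P (2 *\<^sub>R w k - s k) = Cp (2 *\<^sub>R w k - s k) - Dp (2 *\<^sub>R w k - s k)"
    by (simp only: Cp_minus_Dp)
  moreover have "s k = Cp (s k) + Dp (s k)" by (simp only: Cp_plus_Dp)
  ultimately have "s k - P (2 *\<^sub>R w k - s k) = 2 *\<^sub>R (a k + e k)"
    by (simp add: a_def e_def Cp_simps Dp_simps algebra_simps scaleR_2)
  then show ?thesis by (simp add: F_def)
qed

lemma Cp_F: "Cp (F k) = a k" and Dp_F: "Dp (F k) = e k"
  by (simp_all add: F_eq a_def e_def Cp_simps Dp_simps Cp_Cp Dp_Dp Cp_Dp Dp_Cp)

lemma norm_a_le: "norm (a k) \<le> norm (F k)" and norm_e_le: "norm (e k) \<le> norm (F k)"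
  using norm_Cp_le[of "F k"] norm_Dp_le[of "F k"] by (simp_all add: Cp_F Dp_F)

lemma norm_F: "(norm (F k))\<^sup>2 = (norm (a k))\<^sup>2 + (norm (e k))\<^sup>2"
  using norm_split[of "F k"] by (simp add: Cp_F Dp_F)

lemma Cp_s: "Cp (s k) = a k + Cp (w k)"
  by (simp add: a_def Cp_simps)

text \<open>
  This is the subgradient inequality at \<open>w k\<close>, evaluated at the solution.
\<close>
lemma value_gap: "r k - p + (norm (F k))\<^sup>2 \<le> F k \<bullet> (s k - ws)"
proof -
  have "(s k - w k) \<bullet> (ws - w k) = a k \<bullet> (ws - Cp (w k)) - Dp (s k - w k) \<bullet> e k"
    by (simp add: inner_split[of "s k - w k"] a_def e_def Cp_simps Dp_simps Cp_ws Dp_ws)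
  moreover have "F k \<bullet> (s k - ws) = a k \<bullet> (Cp (s k) - ws) + e k \<bullet> Dp (s k)"
    by (simp add: inner_split[of "F k"] Cp_F Dp_F Cp_simps Dp_simps Cp_ws Dp_ws)
  ultimately have "(s k - w k) \<bullet> (ws - w k) = (norm (F k))\<^sup>2 - F k \<bullet> (s k - ws)"
    using norm_F[of k] by (simp add: Cp_s power2_norm_eq_inner e_def Dp_simps inner_simps inner_commute)
  then show ?thesis using subgradient[OF opt_mem, of k] by simp
qed

definition \<kappa> :: real where "\<kappa> = (1 - \<alpha>) / \<alpha>"

lemma \<kappa>_pos: "0 < \<kappa>"
  using \<alpha>_pos \<alpha>_less by (simp add: \<kappa>_def)

text \<open>
  The map from \<open>s\<close> to \<open>P (2 w - s)\<close> is nonexpansive because \<open>w\<close> depends on \<open>s\<close> through a proximal map.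
  Averaging it with the identity leaves a surplus, which makes the squared differences of
  \<open>F\<close> summable.
\<close>
lemma residual_decay: "(norm (F (Suc k)))\<^sup>2 + \<kappa> * (norm (F (Suc k) - F k))\<^sup>2 \<le> (norm (F k))\<^sup>2"
proof -
  define D where "D = F (Suc k) - F k"
  define ds where "ds = s (Suc k) - s k"
  define dw where "dw = w (Suc k) - w k"
  have "2 *\<^sub>R D - ds = - P (2 *\<^sub>R dw - ds)"
    by (simp add: D_def ds_def dw_def F_def P_linear_simps algebra_simps)
  then have "(norm (2 *\<^sub>R D - ds))\<^sup>2 = (norm (2 *\<^sub>R dw - ds))\<^sup>2"
    by (simp add: norm_P)
  then have "(norm D)\<^sup>2 - D \<bullet> ds = dw \<bullet> dw - dw \<bullet> ds"
    by (simp add: power2_norm_eq_inner inner_simps inner_commute)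
  moreover have "dw \<bullet> dw - dw \<bullet> ds \<le> 0"
    using subgradient[OF mem[of k], of "Suc k"] subgradient[OF mem[of "Suc k"], of k]
    by (simp add: dw_def ds_def inner_simps inner_commute algebra_simps)
  moreover have "D \<bullet> ds = - 2 * \<alpha> * (D \<bullet> F k)" by (simp add: ds_def step_F)
  ultimately have "(norm D)\<^sup>2 \<le> - 2 * \<alpha> * (D \<bullet> F k)" by linarith
  then have "2 * (D \<bullet> F k) \<le> - (norm D)\<^sup>2 / \<alpha>" using \<alpha>_pos by (simp add: field_simps)
  moreover have "(norm (F (Suc k)))\<^sup>2 = (norm (F k))\<^sup>2 + 2 * (D \<bullet> F k) + (norm D)\<^sup>2"
    by (simp add: D_def power2_norm_eq_inner inner_simps inner_commute)
  moreover have "\<kappa> * (norm D)\<^sup>2 = (norm D)\<^sup>2 / \<alpha> - (norm D)\<^sup>2"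
    using \<alpha>_pos by (simp add: \<kappa>_def field_simps)
  ultimately show ?thesis unfolding D_def[symmetric] by linarith
qed

lemma norm_F_antimono:
  assumes "i \<le> j" shows "norm (F j) \<le> norm (F i)"
proof -
  have "norm (F (Suc k)) \<le> norm (F k)" for k
  proof (rule power2_le_imp_le)
    have "0 \<le> \<kappa> * (norm (F (Suc k) - F k))\<^sup>2" using \<kappa>_pos by simp
    then show "(norm (F (Suc k)))\<^sup>2 \<le> (norm (F k))\<^sup>2" using residual_decay[of k] by linarith
  qed simp
  then show ?thesis using assms by (rule lift_Suc_antimono_le)
qed

lemma sum_F_differences:
  assumes "n \<le> K"
  shows "\<kappa> * (\<Sum>k\<in>{n..<K}. (norm (F (Suc k) - F k))\<^sup>2) \<le> (norm (F n))\<^sup>2 - (norm (F K))\<^sup>2"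
  using assms
proof (induction rule: dec_induct)
  case (step m)
  then show ?case using residual_decay[of m] by (simp add: algebra_simps)
qed simp

text \<open>
  The point \<open>ws + v\<close> is a fixed point of the iteration only if \<open>v\<close> is an exact multiplier. A defect \<open>\<gamma>\<close> in the dual
  value of \<open>v\<close> costs at most \<open>4 \<alpha> \<gamma>\<close> per step.
\<close>
lemma energy_step:
  assumes v: "Dp v = v" and dual: "\<And>u t. (u, t) \<in> Epi \<Longrightarrow> p - \<gamma> \<le> t - v \<bullet> u"
  shows "(norm (s (Suc k) - ws - v))\<^sup>2 + 4 * \<alpha> * (1 - \<alpha>) * (norm (F k))\<^sup>2
    \<le> (norm (s k - ws - v))\<^sup>2 + 4 * \<alpha> * \<gamma>"
proof -
  have "F k \<bullet> v = w k \<bullet> v"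
    by (metis Dp_F Dp_sym e_def v)
  moreover have "p - \<gamma> \<le> r k - v \<bullet> w k" by (rule dual[OF mem])
  ultimately have "(norm (F k))\<^sup>2 - \<gamma> \<le> F k \<bullet> (s k - ws - v)"
    using value_gap[of k] by (simp add: inner_diff_right inner_commute)
  then have "4 * \<alpha> * ((norm (F k))\<^sup>2 - \<gamma>) \<le> 4 * \<alpha> * (F k \<bullet> (s k - ws - v))"
    using \<alpha>_pos by simp
  moreover have "s (Suc k) - ws - v = (s k - ws - v) - (2 * \<alpha>) *\<^sub>R F k" by (simp add: step_F)
  then have "(norm (s (Suc k) - ws - v))\<^sup>2 = (norm (s k - ws - v))\<^sup>2
      - 4 * \<alpha> * (F k \<bullet> (s k - ws - v)) + 4 * \<alpha>\<^sup>2 * (norm (F k))\<^sup>2"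
    by (simp only: power2_norm_eq_inner inner_diff_left[of "s k - ws - v"] inner_diff_right[of _ "s k - ws - v"]
          inner_scaleR_left inner_scaleR_right)
      (simp add: inner_commute power2_eq_square algebra_simps)
  ultimately show ?thesis by (simp add: power2_eq_square algebra_simps)
qed

lemma energy_sum:
  assumes "Dp v = v" and "\<And>u t. (u, t) \<in> Epi \<Longrightarrow> p - \<gamma> \<le> t - v \<bullet> u"
  shows "(norm (s k - ws - v))\<^sup>2 + 4 * \<alpha> * (1 - \<alpha>) * (\<Sum>i<k. (norm (F i))\<^sup>2)
    \<le> (norm (s 0 - ws - v))\<^sup>2 + 4 * \<alpha> * \<gamma> * real k"
proof (induction k)
  case (Suc k)
  then show ?case using energy_step[OF assms, of k] by (simp add: algebra_simps)
qed simp

text \<open>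
  The accumulated defect is linear in \<open>k\<close> with an arbitrarily small factor, and so is the sum of the
  squared residuals; as these decrease, the last one is at most their mean.
\<close>
lemma residual_small:
  assumes "0 < \<epsilon>"
  shows "eventually (\<lambda>k. norm (F k) \<le> \<epsilon>) sequentially"
proof -
  define \<gamma> where "\<gamma> = (1 - \<alpha>) * \<epsilon>\<^sup>2 / 2"
  have "0 < \<gamma>" using \<alpha>_less assms by (simp add: \<gamma>_def)
  then obtain v where v: "Dp v = v" "\<And>u t. (u, t) \<in> Epi \<Longrightarrow> p - \<gamma> \<le> t - v \<bullet> u"
    using approximate_dual by metis
  define A where "A = (norm (s 0 - ws - v))\<^sup>2"
  have "norm (F k) \<le> \<epsilon>" if k: "A / (4 * \<alpha> * \<gamma>) + 1 \<le> real k" for k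
  proof (rule power2_le_imp_le)
    have "0 \<le> A / (4 * \<alpha> * \<gamma>)" using \<open>0 < \<gamma>\<close> \<alpha>_pos by (simp add: A_def)
    then have "0 < real k" using k by linarith
    have "A / (4 * \<alpha> * \<gamma>) \<le> real k" using k by linarith
    then have A: "A \<le> 4 * \<alpha> * \<gamma> * real k" using \<open>0 < \<gamma>\<close> \<alpha>_pos by (simp add: field_simps)
    have "real k * (norm (F k))\<^sup>2 = (\<Sum>i<k. (norm (F k))\<^sup>2)" by simp
    also have "\<dots> \<le> (\<Sum>i<k. (norm (F i))\<^sup>2)"
      by (intro sum_mono power_mono norm_F_antimono) auto
    finally have "4 * \<alpha> * (1 - \<alpha>) * (real k * (norm (F k))\<^sup>2) \<le> 4 * \<alpha> * (1 - \<alpha>) * (\<Sum>i<k. (norm (F i))\<^sup>2)"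
      using \<alpha>_pos \<alpha>_less by (intro mult_left_mono) auto
    also have "\<dots> \<le> A + 4 * \<alpha> * \<gamma> * real k"
      using energy_sum[OF v, of k] zero_le_power2[of "norm (s k - ws - v)"] unfolding A_def by linarith
    also have "\<dots> \<le> 8 * \<alpha> * \<gamma> * real k" using A by linarith
    also have "\<dots> = 4 * \<alpha> * (1 - \<alpha>) * (real k * \<epsilon>\<^sup>2)" by (simp add: \<gamma>_def)
    finally show "(norm (F k))\<^sup>2 \<le> \<epsilon>\<^sup>2"
      using \<alpha>_pos \<alpha>_less \<open>0 < real k\<close> by simp
  qed (use assms in simp)
  moreover have "eventually (\<lambda>k. A / (4 * \<alpha> * \<gamma>) + 1 \<le> real k) sequentially"
    by (rule eventually_ge_at_top[THEN filterlim_real_sequentially[THEN filterlim_iff[THEN iffD1], rule_format]])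
  ultimately show ?thesis by (auto elim: eventually_mono)
qed

text \<open>
  The same linear bound on the energy shows that \<open>s k\<close>, even if unbounded, grows more slowly than any
  multiple of \<open>sqrt k\<close>.
\<close>
lemma state_growth:
  assumes "0 < \<epsilon>"
  shows "eventually (\<lambda>k. norm (s k - ws) \<le> \<epsilon> * sqrt (real k)) sequentially"
proof -
  define \<gamma> where "\<gamma> = \<epsilon>\<^sup>2 / (16 * \<alpha>)"
  have "0 < \<gamma>" using \<alpha>_pos assms by (simp add: \<gamma>_def)
  then obtain v where v: "Dp v = v" "\<And>u t. (u, t) \<in> Epi \<Longrightarrow> p - \<gamma> \<le> t - v \<bullet> u"
    using approximate_dual by metis
  define A where "A = (norm (s 0 - ws - v))\<^sup>2 + (norm v)\<^sup>2"
  have "norm (s k - ws) \<le> \<epsilon> * sqrt (real k)" if k: "4 * A / \<epsilon>\<^sup>2 \<le> real k" for k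
  proof (rule power2_le_imp_le)
    have A: "4 * A \<le> \<epsilon>\<^sup>2 * real k" using k assms by (simp add: field_simps)
    have "0 \<le> 4 * \<alpha> * (1 - \<alpha>) * (\<Sum>i<k. (norm (F i))\<^sup>2)"
      using \<alpha>_pos \<alpha>_less by (intro mult_nonneg_nonneg sum_nonneg) auto
    then have 1: "(norm (s k - ws - v))\<^sup>2 + (norm v)\<^sup>2 \<le> A + 4 * \<alpha> * \<gamma> * real k"
      using energy_sum[OF v, of k] unfolding A_def by linarith
    have "(norm (s k - ws))\<^sup>2 + (norm (s k - ws - 2 *\<^sub>R v))\<^sup>2 = 2 * ((norm (s k - ws - v))\<^sup>2 + (norm v)\<^sup>2)"
      by (simp add: power2_norm_eq_inner inner_simps inner_commute algebra_simps)
    then have "(norm (s k - ws))\<^sup>2 \<le> 2 * ((norm (s k - ws - v))\<^sup>2 + (norm v)\<^sup>2)"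
      using zero_le_power2[of "norm (s k - ws - 2 *\<^sub>R v)"] by linarith
    also have "\<dots> \<le> 2 * (A + 4 * \<alpha> * \<gamma> * real k)" using 1 by simp
    also have "\<dots> = 2 * A + \<epsilon>\<^sup>2 * real k / 2" using \<alpha>_pos by (simp add: \<gamma>_def)
    finally show "(norm (s k - ws))\<^sup>2 \<le> (\<epsilon> * sqrt (real k))\<^sup>2"
      using A by (simp add: power_mult_distrib)
  qed (use assms in simp)
  moreover have "eventually (\<lambda>k. 4 * A / \<epsilon>\<^sup>2 \<le> real k) sequentially"
    by (rule eventually_ge_at_top[THEN filterlim_real_sequentially[THEN filterlim_iff[THEN iffD1], rule_format]])
  ultimately show ?thesis by (auto elim: eventually_mono)
qed

text \<open>
  This product bounds the excess cost of \<open>w k\<close>. In the absence of a multiplier it is not enough that its first factor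
  tends to \<open>0\<close>, since the second one may be unbounded.
\<close>
definition \<theta> :: "nat \<Rightarrow> real" where "\<theta> k = norm (F k) * norm (s k - ws)"

lemma value_gap_\<theta>: "r k - p \<le> \<theta> k"
proof -
  have "F k \<bullet> (s k - ws) \<le> \<theta> k" unfolding \<theta>_def by (rule norm_cauchy_schwarz)
  then show ?thesis using value_gap[of k] zero_le_power2[of "norm (F k)"] by linarith
qed

text \<open>
  Once the residual is small, the disagreement of \<open>w k\<close> is too small for the first alternative of the growth
  property.
\<close>
lemma primal_distance:
  assumes "0 < \<delta>"
  shows "\<exists>\<eta>>0. eventually (\<lambda>k. norm (w k - ws) < \<delta> \<or> \<eta> * norm (w k - ws) < \<theta> k) sequentially"
proof -
  obtain \<eta> where "0 < \<eta>" and \<eta>: "\<And>u t. (u, t) \<in> Epi \<Longrightarrow> \<delta> \<le> norm (u - ws) \<Longrightarrow>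
      \<eta> * norm (u - ws) < norm (Dp u) \<or> \<eta> * norm (u - ws) < t - p"
    using sharp_growth[OF assms] by auto
  have "norm (w k - ws) < \<delta> \<or> \<eta> * norm (w k - ws) < \<theta> k" if "norm (F k) \<le> \<eta> * \<delta>" for k
  proof (cases "norm (w k - ws) < \<delta>")
    case False
    then have "\<eta> * \<delta> \<le> \<eta> * norm (w k - ws)" using \<open>0 < \<eta>\<close> by simp
    then have "\<not> \<eta> * norm (w k - ws) < norm (Dp (w k))"
      using that norm_e_le[of k] unfolding e_def by linarith
    then show ?thesis using \<eta>[OF mem[of k]] False value_gap_\<theta>[of k] by linarith
  qed simp
  moreover have "eventually (\<lambda>k. norm (F k) \<le> \<eta> * \<delta>) sequentially"
    using \<open>0 < \<eta>\<close> assms by (intro residual_small) simp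
  ultimately have "eventually (\<lambda>k. norm (w k - ws) < \<delta> \<or> \<eta> * norm (w k - ws) < \<theta> k) sequentially"
    by (rule eventually_mono[rotated])
  then show ?thesis using \<open>0 < \<eta>\<close> by blast
qed

text \<open>
  With \<open>J\<close> the Moreau envelope of the cost, \<open>L k\<close> is the value at the consensus and disagreement
  parts of \<open>s k\<close> of the function \<open>(c, d) \<mapsto> J (c + d) - (norm d)\<^sup>2 / 2\<close>, which is convex in \<open>c\<close> and concave in \<open>d\<close>.
  Its partial gradients there are \<open>a k\<close> and \<open>- e k\<close>, so the iteration is gradient descent-ascent on it.
\<close>
definition L :: "nat \<Rightarrow> real" where
  "L k = r k + (norm (s k - w k))\<^sup>2 / 2 - (norm (Dp (s k)))\<^sup>2 / 2"

lemma L_step: "2 * \<alpha> * (1 - \<alpha>) * (norm (e k))\<^sup>2 \<le> 2 * \<alpha> * (norm (a k))\<^sup>2 + (L (Suc k) - L k)"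
proof -
  define u where "u = s k - w k"
  define u' where "u' = s (Suc k) - w (Suc k)"
  define d where "d = Dp (s k)"
  have "r k + u \<bullet> (w (Suc k) - w k) \<le> r (Suc k)"
    unfolding u_def by (rule subgradient[OF mem])
  moreover have "w (Suc k) - w k = u - u' - (2 * \<alpha>) *\<^sub>R F k"
    by (simp add: u_def u'_def step_F)
  ultimately have "r k + (u \<bullet> (u - u') - 2 * \<alpha> * (u \<bullet> F k)) \<le> r (Suc k)"
    by (simp add: inner_diff_right[of u "u - u'"])
  moreover have "u \<bullet> (u - u') + ((norm u')\<^sup>2 - (norm u)\<^sup>2) / 2 = (norm (u' - u))\<^sup>2 / 2"
    by (simp add: power2_norm_eq_inner inner_simps inner_commute field_simps)
  ultimately have 1: "r k - 2 * \<alpha> * (u \<bullet> F k) + ((norm u)\<^sup>2 - (norm u')\<^sup>2) / 2 \<le> r (Suc k)"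
    using zero_le_power2[of "norm (u' - u)"] by argo
  have "u \<bullet> F k = (norm (a k))\<^sup>2 + (d - e k) \<bullet> e k"
    using inner_split[of u "F k"]
    by (simp add: Cp_F Dp_F u_def d_def a_def e_def Dp_simps power2_norm_eq_inner)
  then have 2: "u \<bullet> F k = (norm (a k))\<^sup>2 + d \<bullet> e k - (norm (e k))\<^sup>2"
    by (simp add: inner_diff_left power2_norm_eq_inner)
  have Dp_step: "Dp (s (Suc k)) = d - (2 * \<alpha>) *\<^sub>R e k"
    by (simp add: step_F Dp_simps Dp_F d_def)
  have 3: "(norm (Dp (s (Suc k))))\<^sup>2 = (norm d)\<^sup>2 - 4 * \<alpha> * (d \<bullet> e k) + 4 * \<alpha>\<^sup>2 * (norm (e k))\<^sup>2"
    unfolding Dp_step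
    by (simp only: power2_norm_eq_inner inner_diff_left inner_diff_right inner_scaleR_left inner_scaleR_right)
      (simp add: inner_commute power2_eq_square algebra_simps)
  have "L (Suc k) - L k = r (Suc k) - r k + ((norm u')\<^sup>2 - (norm u)\<^sup>2) / 2
      + 2 * \<alpha> * (d \<bullet> e k) - 2 * \<alpha>\<^sup>2 * (norm (e k))\<^sup>2"
    unfolding L_def 3 by (simp add: u_def u'_def d_def field_simps)
  then show ?thesis using 1 unfolding 2 by (simp add: power2_eq_square algebra_simps) argo
qed

lemma L_eq: "L k = r k + (norm (F k))\<^sup>2 / 2 - Dp (s k) \<bullet> e k"
proof -
  have "(norm (s k - w k))\<^sup>2 = (norm (a k))\<^sup>2 + (norm (Dp (s k) - e k))\<^sup>2"
    using norm_split[of "s k - w k"] by (simp add: a_def e_def Dp_simps)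
  then show ?thesis
    using norm_F[of k] by (simp add: L_def power2_norm_eq_inner inner_simps inner_commute field_simps)
qed

lemma L_le: "L k \<le> p + \<theta> k"
proof -
  have "F k \<bullet> (s k - ws) = a k \<bullet> Cp (s k - ws) + e k \<bullet> Dp (s k)"
    by (simp add: inner_split[of "F k"] Cp_F Dp_F Cp_simps Dp_simps Cp_ws Dp_ws)
  moreover have "a k \<bullet> Cp (s k - ws) \<le> norm (a k) * norm (Cp (s k - ws))" by (rule norm_cauchy_schwarz)
  moreover have "\<dots> \<le> \<theta> k" unfolding \<theta>_def by (intro mult_mono norm_a_le norm_Cp_le) auto
  ultimately show ?thesis
    using value_gap[of k] zero_le_power2[of "norm (F k)"] inner_commute[of "e k" "Dp (s k)"]
    unfolding L_eq by linarith
qed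

lemma L_ge: "\<exists>B\<ge>0. \<forall>k. p - B - \<theta> k \<le> L k"
proof -
  obtain v where v: "\<And>u t. (u, t) \<in> Epi \<Longrightarrow> p - 1 \<le> t - v \<bullet> u" and Dv: "Dp v = v"
    using approximate_dual[of 1] by auto
  have "p - (1 + norm v * norm (F 0)) - \<theta> k \<le> L k" for k
  proof -
    have "v \<bullet> w k = v \<bullet> e k" by (metis Dp_sym Dv e_def)
    moreover have "\<bar>v \<bullet> e k\<bar> \<le> norm v * norm (e k)" by (rule Cauchy_Schwarz_ineq2)
    moreover have "norm v * norm (e k) \<le> norm v * norm (F 0)"
      using norm_e_le[of k] norm_F_antimono[of 0 k] by (intro mult_left_mono) auto
    moreover have "Dp (s k) \<bullet> e k \<le> norm (Dp (s k - ws)) * norm (e k)"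
      using norm_cauchy_schwarz[of "Dp (s k)" "e k"] by (simp add: Dp_simps Dp_ws)
    moreover have "norm (Dp (s k - ws)) * norm (e k) \<le> norm (s k - ws) * norm (F k)"
      by (intro mult_mono norm_e_le norm_Dp_le) auto
    ultimately show ?thesis
      using v[OF mem[of k]] zero_le_power2[of "norm (F k)"] unfolding L_eq \<theta>_def
      using mult.commute[of "norm (F k)" "norm (s k - ws)"] mult.commute[of "norm (Dp (s k - ws))" "norm (e k)"]
      by linarith
  qed
  then show ?thesis by (intro exI[of _ "1 + norm v * norm (F 0)"]) simp
qed

text \<open>
  Up to the factor \<open>2 \<alpha>\<close>, \<open>a k\<close> is the decrement of the consensus part of \<open>s k\<close>. If that part stays bounded,
  a long sum of the squares of \<open>a\<close> can be large only if \<open>a\<close> varies.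
\<close>
lemma sum_a_by_parts:
  assumes "n \<le> K" and m: "\<And>k. n \<le> k \<Longrightarrow> k \<le> K \<Longrightarrow> norm (Cp (s k - ws)) \<le> m"
  shows "2 * \<alpha> * (\<Sum>k\<in>{n..<K}. (norm (a k))\<^sup>2)
    \<le> Cp (s n - ws) \<bullet> a n - Cp (s K - ws) \<bullet> a K + m * (\<Sum>k\<in>{n..<K}. norm (F (Suc k) - F k))"
  using assms
proof (induction K rule: dec_induct)
  case (step j)
  define y where "y k = Cp (s k - ws)" for k
  have "y (Suc j) = y j - (2 * \<alpha>) *\<^sub>R a j" by (simp add: y_def step_F Cp_simps Cp_F)
  then have "2 * \<alpha> * (norm (a j))\<^sup>2 = (y j - y (Suc j)) \<bullet> a j" by (simp add: power2_norm_eq_inner)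
  also have "\<dots> = y j \<bullet> a j - y (Suc j) \<bullet> a (Suc j) + y (Suc j) \<bullet> (a (Suc j) - a j)"
    by (simp add: inner_simps)
  also have "y (Suc j) \<bullet> (a (Suc j) - a j) \<le> norm (y (Suc j)) * norm (a (Suc j) - a j)"
    by (rule norm_cauchy_schwarz)
  also have "norm (y (Suc j)) * norm (a (Suc j) - a j) \<le> m * norm (F (Suc j) - F j)"
  proof (rule mult_mono)
    show "norm (y (Suc j)) \<le> m" using step by (simp add: y_def)
    then show "0 \<le> m" using norm_ge_zero order_trans by blast
    show "norm (a (Suc j) - a j) \<le> norm (F (Suc j) - F j)"
      using norm_Cp_le[of "F (Suc j) - F j"] by (simp add: Cp_simps Cp_F)
  qed simp
  finally show ?case using step unfolding y_def by (simp add: algebra_simps)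
qed simp

text \<open>
  The squares of \<open>e\<close> are traded for those of \<open>a\<close> by means of \<open>L\<close>, those of \<open>a\<close> are summed by parts, and
  the variation of \<open>F\<close> that this produces is estimated by Cauchy-Schwarz and the residual decay.
\<close>
lemma window_bound:
  assumes nK: "n \<le> K" and m: "\<And>k. n \<le> k \<Longrightarrow> k \<le> K \<Longrightarrow> norm (Cp (s k - ws)) \<le> m"
    and B: "\<And>k. p - B - \<theta> k \<le> L k"
  shows "2 * \<alpha> * (1 - \<alpha>) * real (K - n) * (norm (F K))\<^sup>2
    \<le> 2 * m * norm (F n) * (2 + sqrt (real (K - n) / \<kappa>)) + B + \<theta> n + \<theta> K"
proof -
  define V where "V = (\<Sum>k\<in>{n..<K}. norm (F (Suc k) - F k))"
  define A where "A = (\<Sum>k\<in>{n..<K}. (norm (a k))\<^sup>2)"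
  define E where "E = (\<Sum>k\<in>{n..<K}. (norm (e k))\<^sup>2)"
  have m0: "0 \<le> m" using m[of n] nK norm_ge_zero order_trans by blast
  have "V\<^sup>2 \<le> (\<Sum>k\<in>{n..<K}. (norm (F (Suc k) - F k))\<^sup>2) * real (K - n)"
    using sum_squared_le_sum_of_squares[of "\<lambda>k. norm (F (Suc k) - F k)" "{n..<K}"] by (simp add: V_def)
  also have "\<dots> \<le> ((norm (F n))\<^sup>2 / \<kappa>) * real (K - n)"
  proof (rule mult_right_mono)
    show "(\<Sum>k\<in>{n..<K}. (norm (F (Suc k) - F k))\<^sup>2) \<le> (norm (F n))\<^sup>2 / \<kappa>"
      using order_trans[OF sum_F_differences[OF nK], of "(norm (F n))\<^sup>2"] \<kappa>_pos
      by (simp add: pos_le_divide_eq mult.commute)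
  qed simp
  also have "\<dots> = (norm (F n) * sqrt (real (K - n) / \<kappa>))\<^sup>2"
    using \<kappa>_pos by (simp add: power_mult_distrib)
  finally have V: "V \<le> norm (F n) * sqrt (real (K - n) / \<kappa>)"
    using \<kappa>_pos by (intro power2_le_imp_le[of V]) auto
  have bnd: "\<bar>Cp (s k - ws) \<bullet> a k\<bar> \<le> m * norm (F n)" if "n \<le> k" "k \<le> K" for k
  proof -
    have "\<bar>Cp (s k - ws) \<bullet> a k\<bar> \<le> norm (Cp (s k - ws)) * norm (a k)" by (rule Cauchy_Schwarz_ineq2)
    also have "\<dots> \<le> m * norm (F n)"
      using m[OF that] m0 norm_a_le[of k] norm_F_antimono[OF that(1)] by (intro mult_mono) auto
    finally show ?thesis .
  qed
  have "2 * \<alpha> * A \<le> 2 * m * norm (F n) + m * V"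
    using sum_a_by_parts[OF nK m] bnd[of n] bnd[of K] nK unfolding A_def V_def by linarith
  also have "m * V \<le> m * (norm (F n) * sqrt (real (K - n) / \<kappa>))" by (rule mult_left_mono[OF V m0])
  finally have A: "2 * \<alpha> * A \<le> m * norm (F n) * (2 + sqrt (real (K - n) / \<kappa>))"
    by (simp add: algebra_simps)
  have "2 * \<alpha> * (1 - \<alpha>) * E \<le> 2 * \<alpha> * A + (L K - L n)"
    unfolding A_def E_def using nK
  proof (induction K rule: dec_induct)
    case (step j)
    then show ?case using L_step[of j] by (simp add: algebra_simps)
  qed simp
  also have "L K - L n \<le> B + \<theta> n + \<theta> K" using L_le[of K] B[of n] by linarith
  finally have E: "2 * \<alpha> * (1 - \<alpha>) * E \<le> 2 * \<alpha> * A + (B + \<theta> n + \<theta> K)" by simp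
  have "0 \<le> A" unfolding A_def by (intro sum_nonneg) simp
  then have "2 * \<alpha> * (1 - \<alpha>) * A \<le> 2 * \<alpha> * A"
    using \<alpha>_pos \<alpha>_less by (simp add: mult_left_le_one_le mult_le_cancel_right1 algebra_simps)
  then have "2 * \<alpha> * (1 - \<alpha>) * (A + E) \<le> 2 * (2 * \<alpha> * A) + (B + \<theta> n + \<theta> K)"
    using E by (simp add: distrib_left)
  also have "\<dots> \<le> 2 * m * norm (F n) * (2 + sqrt (real (K - n) / \<kappa>)) + (B + \<theta> n + \<theta> K)"
    using mult_left_mono[OF A, of 2] by (simp add: algebra_simps)
  finally have *: "2 * \<alpha> * (1 - \<alpha>) * (A + E) \<le> \<dots>" .
  have "real (K - n) * (norm (F K))\<^sup>2 = (\<Sum>k\<in>{n..<K}. (norm (F K))\<^sup>2)" by simp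
  also have "\<dots> \<le> (\<Sum>k\<in>{n..<K}. (norm (F k))\<^sup>2)"
    by (intro sum_mono power_mono norm_F_antimono) auto
  also have "\<dots> = A + E" by (simp add: A_def E_def norm_F sum.distrib)
  finally have "2 * \<alpha> * (1 - \<alpha>) * (real (K - n) * (norm (F K))\<^sup>2) \<le> 2 * \<alpha> * (1 - \<alpha>) * (A + E)"
    using \<alpha>_pos \<alpha>_less by (intro mult_left_mono) auto
  then show ?thesis using * by (simp add: mult.assoc)
qed

text \<open>
  Let \<open>x k = sqrt k * norm (F k)\<close>, and let \<open>X\<close> bound \<open>x\<close> up to \<open>K\<close>. The window from \<open>K / 2\<close> to \<open>K\<close> gives an
  inequality for \<open>(x K)\<^sup>2\<close> in which \<open>X\<close> occurs linearly, except for one quadratic term that comes from the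
  size of the consensus part of \<open>s\<close>. Since \<open>s k\<close> grows more slowly than \<open>sqrt k\<close>, the coefficient of that term is as small
  as desired, so \<open>x\<close> cannot attain arbitrarily large new maxima.
\<close>
lemma residual_rate: "\<exists>C. \<forall>k. sqrt (real k) * norm (F k) \<le> C"
proof -
  obtain B where "0 \<le> B" and B: "\<And>k. p - B - \<theta> k \<le> L k" using L_ge by auto
  obtain \<eta> k1 where "0 < \<eta>" and
    k1: "\<And>k. k1 \<le> k \<Longrightarrow> norm (w k - ws) < 1 \<or> \<eta> * norm (w k - ws) < \<theta> k"
    using primal_distance[of 1] by (auto simp: eventually_sequentially)
  define b where "b = \<alpha> * (1 - \<alpha>)"
  have "0 < b" using \<alpha>_pos \<alpha>_less by (simp add: b_def)
  define c where "c = 2 * (2 + 1 / sqrt \<kappa>)"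
  have "0 < c" using \<kappa>_pos by (simp add: c_def add_pos_nonneg)
  define M where "M = 1 + norm (F 0)"
  \<comment> \<open>Small enough that the quadratic term of the recursion has coefficient at most \<open>b / 2\<close>.\<close>
  define \<epsilon> where "\<epsilon> = min 1 (b * \<eta> / (4 * c))"
  have "0 < \<epsilon>" "\<epsilon> \<le> 1" and \<epsilon>: "2 * c * \<epsilon> / \<eta> \<le> b / 2"
  proof -
    show "0 < \<epsilon>" "\<epsilon> \<le> 1" using \<open>0 < b\<close> \<open>0 < c\<close> \<open>0 < \<eta>\<close> by (simp_all add: \<epsilon>_def)
    have "\<epsilon> \<le> b * \<eta> / (4 * c)" by (simp add: \<epsilon>_def)
    then show "2 * c * \<epsilon> / \<eta> \<le> b / 2" using \<open>0 < c\<close> \<open>0 < \<eta>\<close> by (simp add: field_simps)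
  qed
  obtain k2 where k2: "\<And>k. k2 \<le> k \<Longrightarrow> norm (s k - ws) \<le> \<epsilon> * sqrt (real k)"
    using state_growth[OF \<open>0 < \<epsilon>\<close>] by (auto simp: eventually_sequentially)
  define x where "x k = sqrt (real k) * norm (F k)" for k
  have x_nonneg: "0 \<le> x k" for k by (simp add: x_def)
  define K0 where "K0 = 2 + 2 * (k1 + k2)"
  have recursion: "b * (x K)\<^sup>2 \<le> b / 2 * X\<^sup>2 + (2 * c * M + 2) * X + B"
    if "K0 \<le> K" and X: "\<And>k. k \<le> K \<Longrightarrow> x k \<le> X" for K X
  proof -
    define n where "n = K div 2"
    have n: "n \<le> K" "k1 \<le> n" "k2 \<le> n" "K \<le> 2 * (K - n)" "K \<le> 4 * n"
      using \<open>K0 \<le> K\<close> unfolding n_def K0_def by presburger+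
    have "0 \<le> X" using X[of 0] x_nonneg[of 0] by simp
    have \<theta>: "\<theta> k \<le> \<epsilon> * X" if "n \<le> k" "k \<le> K" for k
    proof -
      have "\<theta> k \<le> norm (F k) * (\<epsilon> * sqrt (real k))"
        unfolding \<theta>_def using that n by (intro mult_left_mono k2) auto
      also have "\<dots> = \<epsilon> * x k" by (simp add: x_def)
      also have "\<dots> \<le> \<epsilon> * X" using X[OF that(2)] \<open>0 < \<epsilon>\<close> by simp
      finally show ?thesis .
    qed
    define m where "m = M + \<epsilon> * X / \<eta>"
    have "0 \<le> m" using \<open>0 \<le> X\<close> \<open>0 < \<epsilon>\<close> \<open>0 < \<eta>\<close> by (simp add: m_def M_def add_nonneg_nonneg)
    have m: "norm (Cp (s k - ws)) \<le> m" if k: "n \<le> k" "k \<le> K" for k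
    proof -
      have "Cp (s k - ws) = a k + Cp (w k - ws)" by (simp add: Cp_simps Cp_s)
      then have "norm (Cp (s k - ws)) \<le> norm (a k) + norm (w k - ws)"
        using norm_triangle_ineq[of "a k" "Cp (w k - ws)"] norm_Cp_le[of "w k - ws"] by simp
      also have "norm (a k) \<le> norm (F 0)"
        using norm_a_le[of k] norm_F_antimono[of 0 k] by linarith
      also have "norm (w k - ws) \<le> 1 + \<epsilon> * X / \<eta>"
      proof (cases "norm (w k - ws) < 1")
        case True
        moreover have "0 \<le> \<epsilon> * X / \<eta>" using \<open>0 \<le> X\<close> \<open>0 < \<epsilon>\<close> \<open>0 < \<eta>\<close> by simp
        ultimately show ?thesis by linarith
      next
        case False
        then have "\<eta> * norm (w k - ws) \<le> \<epsilon> * X" using k1[of k] \<theta>[OF k] k n by fastforce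
        then show ?thesis using \<open>0 < \<eta>\<close> by (simp add: field_simps)
      qed
      finally show ?thesis by (simp add: m_def M_def)
    qed
    have window: "norm (F n) * (2 + sqrt (real (K - n) / \<kappa>)) \<le> c * X"
    proof -
      have "1 \<le> real K" using \<open>K0 \<le> K\<close> by (simp add: K0_def)
      then have "1 \<le> sqrt (real K)" by simp
      moreover have "sqrt (real (K - n) / \<kappa>) \<le> sqrt (real K) * (1 / sqrt \<kappa>)"
        using \<kappa>_pos by (simp add: real_sqrt_divide divide_right_mono)
      ultimately have "2 + sqrt (real (K - n) / \<kappa>) \<le> sqrt (real K) * (2 + 1 / sqrt \<kappa>)"
        unfolding distrib_left by linarith
      also have "\<dots> \<le> (2 * sqrt (real n)) * (2 + 1 / sqrt \<kappa>)"
      proof (rule mult_right_mono)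
        have "sqrt (real K) \<le> sqrt (4 * real n)" using n(5) by simp
        then show "sqrt (real K) \<le> 2 * sqrt (real n)" by (simp add: real_sqrt_mult)
        show "0 \<le> 2 + 1 / sqrt \<kappa>" using \<kappa>_pos by simp
      qed
      finally have "2 + sqrt (real (K - n) / \<kappa>) \<le> sqrt (real n) * c" by (simp add: c_def algebra_simps)
      then have "norm (F n) * (2 + sqrt (real (K - n) / \<kappa>)) \<le> norm (F n) * (sqrt (real n) * c)"
        by (rule mult_left_mono) simp
      also have "\<dots> = c * x n" by (simp add: x_def)
      also have "\<dots> \<le> c * X" using X[OF n(1)] \<open>0 < c\<close> by simp
      finally show ?thesis .
    qed
    have "b * (x K)\<^sup>2 = b * (real K * (norm (F K))\<^sup>2)" by (simp add: x_def power_mult_distrib)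
    also have "\<dots> \<le> b * (2 * real (K - n) * (norm (F K))\<^sup>2)"
      using \<open>0 < b\<close> n(4) by (intro mult_left_mono mult_right_mono) auto
    also have "\<dots> = 2 * \<alpha> * (1 - \<alpha>) * real (K - n) * (norm (F K))\<^sup>2" by (simp add: b_def)
    also have "\<dots> \<le> 2 * m * norm (F n) * (2 + sqrt (real (K - n) / \<kappa>)) + B + \<theta> n + \<theta> K"
      by (rule window_bound[OF n(1) m B])
    also have "\<dots> \<le> 2 * m * (c * X) + B + 2 * X"
    proof -
      have "2 * m * (norm (F n) * (2 + sqrt (real (K - n) / \<kappa>))) \<le> 2 * m * (c * X)"
        using \<open>0 \<le> m\<close> by (intro mult_left_mono window) auto
      moreover have "\<epsilon> * X \<le> X" using \<open>\<epsilon> \<le> 1\<close> \<open>0 \<le> X\<close> by (simp add: mult_left_le_one_le \<open>0 < \<epsilon>\<close> less_imp_le)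
      moreover have "\<theta> n \<le> \<epsilon> * X" "\<theta> K \<le> \<epsilon> * X" using \<theta> n(1) by auto
      ultimately show ?thesis by (simp add: mult.assoc)
    qed
    also have "2 * m * (c * X) = 2 * c * M * X + (2 * c * \<epsilon> / \<eta>) * X\<^sup>2"
      by (simp add: m_def power2_eq_square algebra_simps)
    also have "(2 * c * \<epsilon> / \<eta>) * X\<^sup>2 \<le> b / 2 * X\<^sup>2" by (rule mult_right_mono[OF \<epsilon>]) simp
    finally show ?thesis by (simp add: algebra_simps)
  qed
  define D where "D = 2 * c * M + 2"
  have "0 < D" using \<open>0 < c\<close> by (simp add: D_def M_def add_pos_nonneg add_nonneg_pos)
  \<comment> \<open>If \<open>x K\<close> is a new maximum, the recursion applies with \<open>X = x K\<close> and bounds it by \<open>2 (D + B) / b\<close>.\<close>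
  define Y where "Y = Max (insert (max 1 (2 * (D + B) / b)) (x ` {..K0}))"
  have Y: "max 1 (2 * (D + B) / b) \<le> Y" "\<And>k. k \<le> K0 \<Longrightarrow> x k \<le> Y"
    unfolding Y_def by (rule Max_ge; simp)+
  have "x k \<le> Y" for k
  proof (induction k rule: less_induct)
    case (less K)
    show ?case
    proof (rule ccontr)
      assume "\<not> x K \<le> Y"
      then have xK: "Y < x K" by simp
      then have "K0 \<le> K" using Y(2)[of K] by (cases "K \<le> K0") auto
      moreover have "x k \<le> x K" if "k \<le> K" for k
        using less[of k] xK that by (cases "k = K") auto
      ultimately have "b * (x K)\<^sup>2 \<le> b / 2 * (x K)\<^sup>2 + D * x K + B"
        unfolding D_def by (rule recursion)
      moreover have "1 < x K" using Y(1) xK by simp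
      then have "B \<le> B * x K" using \<open>0 \<le> B\<close> by (simp add: mult_le_cancel_left1)
      ultimately have "b / 2 * x K * x K \<le> (D + B) * x K"
        by (simp add: power2_eq_square algebra_simps)
      then have "b / 2 * x K \<le> D + B" using \<open>1 < x K\<close> by simp
      then have "x K \<le> 2 * (D + B) / b" using \<open>0 < b\<close> by (simp add: field_simps)
      then show False using Y(1) xK by simp
    qed
  qed
  then show ?thesis unfolding x_def by blast
qed

lemma \<theta>_small:
  assumes "0 < \<epsilon>"
  shows "eventually (\<lambda>k. \<theta> k \<le> \<epsilon>) sequentially"
proof -
  obtain C where C: "\<And>k. sqrt (real k) * norm (F k) \<le> C" using residual_rate by blast
  have "0 \<le> C" using C[of 0] by simp
  have "eventually (\<lambda>k. norm (s k - ws) \<le> \<epsilon> / (C + 1) * sqrt (real k)) sequentially"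
    using assms \<open>0 \<le> C\<close> by (intro state_growth) simp
  then show ?thesis
  proof (rule eventually_mono)
    fix k assume k: "norm (s k - ws) \<le> \<epsilon> / (C + 1) * sqrt (real k)"
    have "\<theta> k \<le> norm (F k) * (\<epsilon> / (C + 1) * sqrt (real k))"
      unfolding \<theta>_def by (intro mult_left_mono k) simp
    also have "\<dots> = \<epsilon> / (C + 1) * (sqrt (real k) * norm (F k))" by simp
    also have "\<dots> \<le> \<epsilon> / (C + 1) * (C + 1)"
      using C[of k] assms \<open>0 \<le> C\<close> by (intro mult_left_mono) auto
    also have "\<dots> = \<epsilon>" using \<open>0 \<le> C\<close> by simp
    finally show "\<theta> k \<le> \<epsilon>" .
  qed
qed

theorem primal_convergence: "w \<longlonglongrightarrow> ws"
proof (rule tendstoI)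
  fix \<delta> :: real assume "0 < \<delta>"
  then obtain \<eta> where "0 < \<eta>" and
    1: "eventually (\<lambda>k. norm (w k - ws) < \<delta> \<or> \<eta> * norm (w k - ws) < \<theta> k) sequentially"
    using primal_distance by blast
  have "eventually (\<lambda>k. \<theta> k \<le> \<eta> * \<delta>) sequentially"
    using \<open>0 < \<eta>\<close> \<open>0 < \<delta>\<close> by (intro \<theta>_small) simp
  with 1 show "eventually (\<lambda>k. dist (w k) ws < \<delta>) sequentially"
  proof eventually_elim
    case (elim k)
    have "norm (w k - ws) < \<delta>" if "\<eta> * norm (w k - ws) < \<theta> k"
    proof -
      have "\<eta> * norm (w k - ws) < \<eta> * \<delta>" using that elim(2) by linarith
      then show ?thesis using \<open>0 < \<eta>\<close> by simp
    qed
    then show ?case using elim(1) by (auto simp: dist_norm)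
  qed
qed

end


section \<open>The partition-based algorithm as an instance\<close>

text \<open>
  These are the triples for which \<open>z\<^sub>c\<^sup>(\<^sup>j\<^sup>,\<^sup>i\<^sup>)\<close> is one of the auxiliary variables. Stacked vectors vanish at all other
  triples; the padding places them in a Euclidean space indexed by a type.
\<close>
definition relevant :: "('v \<times> 'v) set \<Rightarrow> 'v \<Rightarrow> 'v \<Rightarrow> 'v \<Rightarrow> bool" where
  "relevant E c j i \<longleftrightarrow> (i, j) \<in> E \<and> (c = i \<or> c = j)"

definition edge_vec :: "('v::finite \<times> 'v) set \<Rightarrow> ('v \<Rightarrow> 'v \<Rightarrow> 'v \<Rightarrow> real ^ 'n) \<Rightarrow> (real ^ 'n) ^ ('v \<times> 'v \<times> 'v)" where
  "edge_vec E h = (\<chi> q. case q of (c, j, i) \<Rightarrow> if relevant E c j i then h c j i else 0)"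

definition stack :: "('v::finite \<times> 'v) set \<Rightarrow> ('v \<Rightarrow> 'v \<Rightarrow> real ^ 'n) \<Rightarrow> (real ^ 'n) ^ ('v \<times> 'v \<times> 'v)" where
  "stack E x = edge_vec E (\<lambda>c j i. x i c)"

definition swap_edges :: "(real ^ 'n) ^ ('v::finite \<times> 'v \<times> 'v) \<Rightarrow> (real ^ 'n) ^ ('v \<times> 'v \<times> 'v)" where
  "swap_edges w = (\<chi> q. case q of (c, j, i) \<Rightarrow> w $ (c, i, j))"

lemma edge_vec_nth [simp]: "edge_vec E h $ (c, j, i) = (if relevant E c j i then h c j i else 0)"
  by (simp add: edge_vec_def)

lemma swap_edges_nth [simp]: "swap_edges w $ (c, j, i) = w $ (c, i, j)"
  by (simp add: swap_edges_def)

lemma stack_nth [simp]: "stack E x $ (c, j, i) = (if relevant E c j i then x i c else 0)"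
  by (simp add: stack_def)

lemma triple_vec_eqI: "(\<And>c j i. v $ (c, j, i) = w $ (c, j, i)) \<Longrightarrow> v = w"
  by (simp add: vec_eq_iff)

lemma linear_swap_edges: "linear swap_edges"
  by (rule linearI) (auto intro!: triple_vec_eqI)

lemma swap_edges_swap_edges: "swap_edges (swap_edges w) = w"
  by (auto intro!: triple_vec_eqI)

lemma swap_edges_inner: "swap_edges v \<bullet> w = v \<bullet> swap_edges w"
  unfolding inner_vec_def
  by (rule sum.reindex_bij_witness[of _ "\<lambda>(c, j, i). (c, i, j)" "\<lambda>(c, j, i). (c, i, j)"]) auto

lemma norm_edge_vec:
  assumes "irrefl E"
  shows "(norm (edge_vec E h))\<^sup>2 = (\<Sum>i\<in>UNIV. \<Sum>j\<in>neighbors E i. (norm (h i j i))\<^sup>2 + (norm (h j j i))\<^sup>2)"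
proof -
  have "(norm (edge_vec E h))\<^sup>2 = (\<Sum>q\<in>UNIV. (norm (edge_vec E h $ q))\<^sup>2)"
    by (simp add: power2_norm_eq_inner inner_vec_def)
  also have "\<dots> = (\<Sum>(i, j, c)\<in>UNIV. (norm (edge_vec E h $ (c, j, i)))\<^sup>2)"
    by (rule sum.reindex_bij_witness[of _ "\<lambda>(c, j, i). (i, j, c)" "\<lambda>(c, j, i). (i, j, c)"]) auto
  also have "\<dots> = (\<Sum>i\<in>UNIV. \<Sum>j\<in>UNIV. \<Sum>c\<in>UNIV. (norm (edge_vec E h $ (c, j, i)))\<^sup>2)"
    by (simp add: sum.cartesian_product)
  also have "\<dots> = (\<Sum>i\<in>UNIV. \<Sum>j\<in>UNIV. if j \<in> neighbors E i then (norm (h i j i))\<^sup>2 + (norm (h j j i))\<^sup>2 else 0)"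
  proof (intro sum.cong refl)
    fix i j
    show "(\<Sum>c\<in>UNIV. (norm (edge_vec E h $ (c, j, i)))\<^sup>2)
      = (if j \<in> neighbors E i then (norm (h i j i))\<^sup>2 + (norm (h j j i))\<^sup>2 else 0)"
    proof (cases "j \<in> neighbors E i")
      case True
      then have "(i, j) \<in> E" "i \<noteq> j" using assms by (auto simp: neighbors_def irrefl_def)
      have "(\<Sum>c\<in>UNIV. (norm (edge_vec E h $ (c, j, i)))\<^sup>2) = (\<Sum>c\<in>{i, j}. (norm (edge_vec E h $ (c, j, i)))\<^sup>2)"
        by (rule sum.mono_neutral_right) (auto simp: relevant_def)
      then show ?thesis using True \<open>(i, j) \<in> E\<close> \<open>i \<noteq> j\<close> by (simp add: relevant_def)
    qed (simp add: relevant_def neighbors_def)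
  qed
  also have "\<dots> = (\<Sum>i\<in>UNIV. \<Sum>j\<in>neighbors E i. (norm (h i j i))\<^sup>2 + (norm (h j j i))\<^sup>2)"
    by (simp add: sum.If_cases)
  finally show ?thesis .
qed

text \<open>
  Convexity in terms of real bounds on the values. At the endpoints \<open>t = 0\<close> and \<open>t = 1\<close> the combination is \<open>x\<close> or
  \<open>y\<close> itself because families are extensional.
\<close>
lemma convex_function_le:
  assumes "convex_function S f" and "x \<in> families S" "y \<in> families S"
    and fx: "f x \<le> ereal a" and fy: "f y \<le> ereal b" and "0 \<le> t" "t \<le> 1"
  shows "f (\<lambda>j\<in>S. (1 - t) *\<^sub>R x j + t *\<^sub>R y j) \<le> ereal ((1 - t) * a + t * b)"
proof -
  consider "t = 0" | "t = 1" | "0 < t" "t < 1" using assms(6,7) by linarith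
  then show ?thesis
  proof cases
    case 1
    have "restrict x S = x" using assms(2) by (simp add: PiE_restrict)
    then show ?thesis using fx 1 by simp
  next
    case 2
    have "restrict y S = y" using assms(3) by (simp add: PiE_restrict)
    then show ?thesis using fy 2 by simp
  next
    case 3
    have "f (\<lambda>j\<in>S. (1 - t) *\<^sub>R x j + t *\<^sub>R y j) \<le> ereal (1 - t) * f x + ereal t * f y"
      using assms(1-3) 3 by (simp add: convex_function_def)
    also have "\<dots> \<le> ereal (1 - t) * ereal a + ereal t * ereal b"
      using 3 by (intro add_mono ereal_mult_left_mono fx fy) auto
    finally show ?thesis by simp
  qed
qed

text \<open>
  Lower semicontinuity along sequences: closedness of the sublevel sets says that superlevel sets are
  open.
\<close>
lemma closed_function_eventually:
  assumes "closed_function S f" and y: "\<And>n. y n \<in> families S" and l: "l \<in> families S"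
    and lim: "\<And>j. j \<in> S \<Longrightarrow> (\<lambda>n. y n j) \<longlonglongrightarrow> l j" and "ereal b < f l"
  shows "eventually (\<lambda>n. ereal b < f (y n)) sequentially"
proof -
  let ?T = "product_topology (\<lambda>_. euclidean) S"
  have "limitin ?T y l sequentially"
    using lim l y by (simp add: limitin_componentwise PiE_iff limitin_canonical_iff)
  moreover have "openin ?T (topspace ?T - {x \<in> families S. f x \<le> ereal b})"
    using assms(1) unfolding closed_function_def by (intro openin_diff openin_topspace) blast
  moreover have "l \<in> topspace ?T - {x \<in> families S. f x \<le> ereal b}"
    using l assms(5) by (simp add: not_le)
  ultimately have "eventually (\<lambda>n. y n \<in> topspace ?T - {x \<in> families S. f x \<le> ereal b}) sequentially"
    unfolding limitin_def by blast
  then show ?thesis by (rule eventually_mono) (use y in \<open>auto simp: not_le\<close>)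
qed

lemma is_arg_min_arg_min:
  assumes "is_arg_min g P y" shows "is_arg_min g P (arg_min g P)"
  unfolding arg_min_def using someI[of "is_arg_min g P", OF assms] by simp

locale partitioned_problem =
  fixes E :: "('v::finite \<times> 'v) set" and f :: "'v \<Rightarrow> ('v \<Rightarrow> real ^ 'n) \<Rightarrow> ereal"
    and xs :: "'v \<Rightarrow> real ^ 'n" and \<rho> :: real
  assumes sym_E: "sym E" and irrefl_E: "irrefl E"
    and closed_f: "\<And>i. closed_function (closed_nbhd E i) (f i)"
    and proper_f: "\<And>i. proper_function (closed_nbhd E i) (f i)"
    and convex_f: "\<And>i. convex_function (closed_nbhd E i) (f i)"
    and opt: "optimal_solution E f xs"
    and unique: "\<And>y. optimal_solution E f y \<Longrightarrow> y = xs"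
    and \<rho>_pos: "0 < \<rho>"
begin

abbreviation "nb i \<equiv> closed_nbhd E i"

text \<open>
  An isolated node has no auxiliary variables, so the stacked problem can only concern the remaining nodes.
\<close>
definition active :: "'v set" where "active = {i. neighbors E i \<noteq> {}}"

lemma f_not_minf: "x \<in> families (nb i) \<Longrightarrow> f i x \<noteq> - \<infinity>"
  using proper_f by (simp add: proper_function_def)

lemma total_cost_minimal: "total_cost E f xs \<le> total_cost E f y"
  using opt by (simp add: optimal_solution_def is_arg_min_def not_less)

definition \<phi> :: "'v \<Rightarrow> real" where "\<phi> i = real_of_ereal (f i (restrict xs (nb i)))"

lemma f_xs: "f i (restrict xs (nb i)) = ereal (\<phi> i)"
proof -
  have "total_cost E f xs \<noteq> \<infinity>"
  proof
    assume inf: "total_cost E f xs = \<infinity>"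
    have "optimal_solution E f (\<lambda>i. xs i + 1)"
      \<comment> \<open>If the minimal cost were infinite, every point would be optimal.\<close>
      unfolding optimal_solution_def is_arg_min_def
      using total_cost_minimal inf by (metis ereal_infty_less_eq(1) not_less)
    then have "(\<lambda>i. xs i + 1) = xs" by (rule unique)
    then have "xs i + 1 = xs i" by metis
    then show False by simp
  qed
  then have "f i (restrict xs (nb i)) \<noteq> \<infinity>"
    by (auto simp: total_cost_def sum_Pinfty)
  moreover have "f i (restrict xs (nb i)) \<noteq> - \<infinity>" by (rule f_not_minf) simp
  ultimately show ?thesis unfolding \<phi>_def by (cases "f i (restrict xs (nb i))") auto
qed

text \<open>
  Real upper bounds \<open>\<tau> i\<close> in place of the extended costs allow replacing the costs of single nodes and
  comparing the sums by real arithmetic.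
\<close>
lemma optimality:
  assumes "\<And>i. f i (restrict X (nb i)) \<le> ereal (\<tau> i)"
  shows "(\<Sum>i\<in>UNIV. \<phi> i) \<le> (\<Sum>i\<in>UNIV. \<tau> i)"
    and "(\<Sum>i\<in>UNIV. \<tau> i) \<le> (\<Sum>i\<in>UNIV. \<phi> i) \<Longrightarrow> X = xs"
proof -
  have xs: "total_cost E f xs = ereal (\<Sum>i\<in>UNIV. \<phi> i)"
    by (simp add: total_cost_def f_xs)
  have X: "total_cost E f X \<le> ereal (\<Sum>i\<in>UNIV. \<tau> i)"
    unfolding total_cost_def sum_ereal[symmetric] by (intro sum_mono assms)
  show "(\<Sum>i\<in>UNIV. \<phi> i) \<le> (\<Sum>i\<in>UNIV. \<tau> i)"
    using order_trans[OF total_cost_minimal[of X] X] by (simp add: xs)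
  assume "(\<Sum>i\<in>UNIV. \<tau> i) \<le> (\<Sum>i\<in>UNIV. \<phi> i)"
  then have "total_cost E f X \<le> total_cost E f xs"
    using X unfolding xs by (meson ereal_less_eq(3) order_trans)
  then have "optimal_solution E f X"
    unfolding optimal_solution_def is_arg_min_def using total_cost_minimal by (metis not_less order_trans)
  then show "X = xs" by (rule unique)
qed

text \<open>
  The epigraph of the total cost of the active nodes, divided by \<open>\<rho>\<close>, in terms of the stacked copies. A
  separate real bound \<open>\<tau> i\<close> on each cost avoids sums of extended reals.
\<close>
definition Epi :: "(((real ^ 'n) ^ ('v \<times> 'v \<times> 'v)) \<times> real) set" where
  "Epi = {(u, t). \<exists>x \<tau>. (\<forall>i\<in>active. x i \<in> families (nb i) \<and> f i (x i) \<le> ereal (\<tau> i)) \<and>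
      u = stack E x \<and> (\<Sum>i\<in>active. \<tau> i) \<le> \<rho> * t}"

lemma EpiI:
  assumes "\<And>i. i \<in> active \<Longrightarrow> x i \<in> families (nb i)" "\<And>i. i \<in> active \<Longrightarrow> f i (x i) \<le> ereal (\<tau> i)"
    and "(\<Sum>i\<in>active. \<tau> i) \<le> \<rho> * t"
  shows "(stack E x, t) \<in> Epi"
  unfolding Epi_def using assms by blast

lemma EpiE:
  assumes "(u, t) \<in> Epi"
  obtains x \<tau> where "\<And>i. i \<in> active \<Longrightarrow> x i \<in> families (nb i)" "\<And>i. i \<in> active \<Longrightarrow> f i (x i) \<le> ereal (\<tau> i)"
    "u = stack E x" "(\<Sum>i\<in>active. \<tau> i) \<le> \<rho> * t"
  using assms unfolding Epi_def by blast

definition pstar :: real where "pstar = (\<Sum>i\<in>active. \<phi> i) / \<rho>"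
definition wstar :: "(real ^ 'n) ^ ('v \<times> 'v \<times> 'v)" where "wstar = stack E (\<lambda>i. restrict xs (nb i))"

lemma relevant_active: "relevant E c j i \<Longrightarrow> i \<in> active"
  by (auto simp: relevant_def active_def neighbors_def)

lemma relevant_nb: "relevant E c j i \<Longrightarrow> c \<in> nb i"
  by (auto simp: relevant_def closed_nbhd_def neighbors_def)

lemma relevant_swap: "relevant E c i j \<longleftrightarrow> relevant E c j i"
  using sym_E by (auto simp: relevant_def sym_def)

lemma stack_cong: "(\<And>i. i \<in> active \<Longrightarrow> x i = y i) \<Longrightarrow> stack E x = stack E y"
  by (rule triple_vec_eqI) (simp add: relevant_active)

text \<open>
  A stacked vector invariant under the exchange consists of copies of a single vector \<open>X\<close>: if \<open>c\<close> is a
  neighbor of \<open>i\<close>, the entries \<open>(c, c, i)\<close> and \<open>(c, i, c)\<close> equate the copy of \<open>c\<close> held by \<open>i\<close> with the own value of \<open>c\<close>.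
  At isolated nodes \<open>X\<close> is completed by the optimal solution.
\<close>
lemma consensus:
  assumes x: "\<And>i. i \<in> active \<Longrightarrow> x i \<in> families (nb i)" "\<And>i. i \<in> active \<Longrightarrow> f i (x i) \<le> ereal (\<tau> i)"
    and swap: "swap_edges (stack E x) = stack E x"
  shows "(\<Sum>i\<in>active. \<phi> i) \<le> (\<Sum>i\<in>active. \<tau> i)"
    and "(\<Sum>i\<in>active. \<tau> i) \<le> (\<Sum>i\<in>active. \<phi> i) \<Longrightarrow> stack E x = wstar"
proof -
  define X where "X c = (if c \<in> active then x c c else xs c)" for c
  define \<tau>' where "\<tau>' i = (if i \<in> active then \<tau> i else \<phi> i)" for i
  have copies: "x i = restrict X (nb i)" if i: "i \<in> active" for i
  proof
    fix c
    show "x i c = restrict X (nb i) c"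
    proof (cases "c \<in> nb i")
      case False
      then show ?thesis using x(1)[OF i] by (auto simp: PiE_def extensional_def)
    next
      case True
      then consider "c = i" | "(i, c) \<in> E" by (auto simp: closed_nbhd_def neighbors_def)
      then show ?thesis
      proof cases
        case 2
        then have ci: "(c, i) \<in> E" using sym_E by (auto simp: sym_def)
        have "c \<in> active" using ci by (auto simp: active_def neighbors_def)
        moreover have "stack E x $ (c, c, i) = stack E x $ (c, i, c)"
          using swap by (metis swap_edges_nth)
        ultimately show ?thesis using 2 ci True by (simp add: relevant_def X_def)
      qed (use True i in \<open>simp add: X_def\<close>)
    qed
  qed
  have "restrict X (nb i) = restrict xs (nb i)" if "i \<notin> active" for i
    using that by (auto simp: closed_nbhd_def active_def X_def restrict_def fun_eq_iff)
  then have le: "f i (restrict X (nb i)) \<le> ereal (\<tau>' i)" for i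
    using x(2)[of i] copies[of i] f_xs[of i] by (cases "i \<in> active") (simp_all add: \<tau>'_def)
  have split: "(\<Sum>i\<in>UNIV. g i) = (\<Sum>i\<in>active. g i) + (\<Sum>i\<in>- active. g i)" for g :: "'v \<Rightarrow> real"
    by (metis Compl_partition finite_class.finite_UNIV finite_subset subset_UNIV sum.union_disjoint Compl_disjoint)
  have sums: "(\<Sum>i\<in>active. \<tau>' i) = (\<Sum>i\<in>active. \<tau> i)" "(\<Sum>i\<in>- active. \<tau>' i) = (\<Sum>i\<in>- active. \<phi> i)"
    by (simp_all add: \<tau>'_def)
  show "(\<Sum>i\<in>active. \<phi> i) \<le> (\<Sum>i\<in>active. \<tau> i)"
    using optimality(1)[OF le] unfolding split sums by simp
  assume "(\<Sum>i\<in>active. \<tau> i) \<le> (\<Sum>i\<in>active. \<phi> i)"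
  then have "X = xs" using optimality(2)[OF le] unfolding split sums by simp
  then show "stack E x = wstar" unfolding wstar_def by (intro stack_cong) (simp add: copies)
qed

text \<open>
  Every copy held by an active node occurs in the stacked vector, so convergence of the latter passes to the
  former.
\<close>
lemma stack_limit:
  assumes "(\<lambda>n. stack E (x n)) \<longlonglongrightarrow> u" and "\<And>n i. i \<in> active \<Longrightarrow> x n i \<in> families (nb i)"
  shows "\<exists>xl. u = stack E xl \<and> (\<forall>i. xl i \<in> families (nb i)) \<and>
    (\<forall>i\<in>active. \<forall>c\<in>nb i. (\<lambda>n. x n i c) \<longlonglongrightarrow> xl i c)"
proof -
  have "\<exists>l. (\<lambda>n. x n i c) \<longlonglongrightarrow> l" if i: "i \<in> active" and c: "c \<in> nb i" for i c
  proof -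
    obtain j0 where "(i, j0) \<in> E" using i by (auto simp: active_def neighbors_def)
    define j where "j = (if c = i then j0 else c)"
    have j: "relevant E c j i"
      using c \<open>(i, j0) \<in> E\<close> by (auto simp: j_def relevant_def closed_nbhd_def neighbors_def)
    have "(\<lambda>n. stack E (x n) $ (c, j, i)) \<longlonglongrightarrow> u $ (c, j, i)"
      by (intro tendsto_vec_nth assms)
    then show ?thesis using j by auto
  qed
  then obtain l where l: "\<And>i c. i \<in> active \<Longrightarrow> c \<in> nb i \<Longrightarrow> (\<lambda>n. x n i c) \<longlonglongrightarrow> l i c"
    by metis
  define xl where "xl i = restrict (l i) (nb i)" for i
  have lim: "(\<lambda>n. x n i c) \<longlonglongrightarrow> xl i c" if "i \<in> active" "c \<in> nb i" for i c
    using l[OF that] that by (simp add: xl_def)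
  have "u = stack E xl"
  proof (rule triple_vec_eqI)
    fix c j i
    have "(\<lambda>n. stack E (x n) $ (c, j, i)) \<longlonglongrightarrow> u $ (c, j, i)"
      by (intro tendsto_vec_nth assms)
    moreover have "(\<lambda>n. stack E (x n) $ (c, j, i)) \<longlonglongrightarrow> stack E xl $ (c, j, i)"
      using lim[of i c] by (simp add: relevant_active relevant_nb)
    ultimately show "u $ (c, j, i) = stack E xl $ (c, j, i)" by (rule LIMSEQ_unique)
  qed
  moreover have "xl i \<in> families (nb i)" for i by (simp add: xl_def)
  ultimately show ?thesis using lim by (intro exI[of _ xl]) simp
qed

text \<open>
  The bounds \<open>\<tau> n i\<close> need not converge. Instead, lower semicontinuity makes them exceed eventually any numbers
  \<open>b i\<close> below the costs at the limit, so that the sum of the \<open>b i\<close> is at most \<open>\<rho>\<close> times the limiting bound. That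
  excludes infinite costs at the limit and gives the claim as \<open>b i\<close> approaches those costs.
\<close>
lemma closed_Epi: "closed Epi"
  unfolding closed_sequential_limits
proof (intro allI impI, elim conjE)
  fix q :: "nat \<Rightarrow> ((real ^ 'n) ^ ('v \<times> 'v \<times> 'v)) \<times> real" and l
  assume mem: "\<forall>n. q n \<in> Epi" and q: "q \<longlonglongrightarrow> l"
  have "\<exists>x \<tau>. (\<forall>i\<in>active. x i \<in> families (nb i)) \<and> (\<forall>i\<in>active. f i (x i) \<le> ereal (\<tau> i)) \<and>
      fst (q n) = stack E x \<and> (\<Sum>i\<in>active. \<tau> i) \<le> \<rho> * snd (q n)" for n
  proof -
    have "(fst (q n), snd (q n)) \<in> Epi" using mem by simp
    then show ?thesis by (rule EpiE) blast
  qed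
  then obtain x \<tau> where x: "\<And>n i. i \<in> active \<Longrightarrow> x n i \<in> families (nb i)"
    and \<tau>: "\<And>n i. i \<in> active \<Longrightarrow> f i (x n i) \<le> ereal (\<tau> n i)"
    and fst: "\<And>n. fst (q n) = stack E (x n)" and sum: "\<And>n. (\<Sum>i\<in>active. \<tau> n i) \<le> \<rho> * snd (q n)"
    by metis
  have "(\<lambda>n. stack E (x n)) \<longlonglongrightarrow> fst l" using tendsto_fst[OF q] by (simp add: fst)
  from stack_limit[OF this x] obtain xl where xl: "fst l = stack E xl" "\<And>i. xl i \<in> families (nb i)"
    and lim: "\<And>i c. i \<in> active \<Longrightarrow> c \<in> nb i \<Longrightarrow> (\<lambda>n. x n i c) \<longlonglongrightarrow> xl i c"
    by auto
  have below: "(\<Sum>i\<in>active. b i) \<le> \<rho> * snd l" if b: "\<And>i. i \<in> active \<Longrightarrow> ereal (b i) < f i (xl i)" for b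
  proof (rule tendsto_lowerbound)
    show "(\<lambda>n. \<rho> * snd (q n)) \<longlonglongrightarrow> \<rho> * snd l" by (intro tendsto_intros q)
    have "eventually (\<lambda>n. ereal (b i) < f i (x n i)) sequentially" if "i \<in> active" for i
      by (rule closed_function_eventually[OF closed_f x[OF that] xl(2) lim[OF that] b[OF that]])
    then have "eventually (\<lambda>n. \<forall>i\<in>active. ereal (b i) < f i (x n i)) sequentially"
      by (simp add: eventually_ball_finite)
    then show "eventually (\<lambda>n. (\<Sum>i\<in>active. b i) \<le> \<rho> * snd (q n)) sequentially"
    proof (rule eventually_mono)
      fix n assume *: "\<forall>i\<in>active. ereal (b i) < f i (x n i)"
      have "(\<Sum>i\<in>active. b i) \<le> (\<Sum>i\<in>active. \<tau> n i)"
      proof (rule sum_mono)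
        fix i assume "i \<in> active"
        then have "ereal (b i) < ereal (\<tau> n i)" using * \<tau> less_le_trans by blast
        then show "b i \<le> \<tau> n i" by simp
      qed
      then show "(\<Sum>i\<in>active. b i) \<le> \<rho> * snd (q n)" using sum order_trans by blast
    qed
  qed simp
  have "\<exists>b. ereal b < f i (xl i)" if "i \<in> active" for i
    using f_not_minf[OF xl(2)[of i]] by (metis ereal_bot not_le)
  then obtain b where b: "\<And>i. i \<in> active \<Longrightarrow> ereal (b i) < f i (xl i)" by metis
  have "f i (xl i) \<noteq> \<infinity>" if i: "i \<in> active" for i
  proof
    assume inf: "f i (xl i) = \<infinity>"
    \<comment> \<open>An infinite cost at \<open>i\<close> admits any value of \<open>b i\<close>, in particular one that makes the sum too large.\<close>
    define T where "T = \<rho> * snd l + 1 - (\<Sum>j\<in>active - {i}. b j)"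
    have "(\<Sum>j\<in>active. (b(i := T)) j) \<le> \<rho> * snd l" by (rule below) (use b inf in auto)
    moreover have "(\<Sum>j\<in>active. (b(i := T)) j) = T + (\<Sum>j\<in>active - {i}. b j)"
      using i by (simp add: sum.remove[of active i])
    ultimately show False by (simp add: T_def)
  qed
  then have "\<exists>t. f i (xl i) = ereal t" if "i \<in> active" for i
    using f_not_minf[OF xl(2)[of i]] that by (cases "f i (xl i)") auto
  then obtain t where t: "\<And>i. i \<in> active \<Longrightarrow> f i (xl i) = ereal (t i)" by metis
  have "(\<Sum>i\<in>active. t i) \<le> \<rho> * snd l"
  proof (rule field_le_epsilon)
    fix \<delta> :: real assume "0 < \<delta>"
    define d where "d = \<delta> / (real (card active) + 1)"
    have "0 < d" using \<open>0 < \<delta>\<close> by (simp add: d_def)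
    then have "(\<Sum>i\<in>active. t i - d) \<le> \<rho> * snd l" by (intro below) (simp add: t)
    moreover have "real (card active) * d \<le> \<delta>" using \<open>0 < \<delta>\<close> by (simp add: d_def field_simps)
    ultimately show "(\<Sum>i\<in>active. t i) \<le> \<rho> * snd l + \<delta>" by (simp add: sum_subtractf)
  qed
  then have "(stack E xl, snd l) \<in> Epi" by (intro EpiI[of _ t]) (use xl t in auto)
  then show "l \<in> Epi" unfolding xl(1)[symmetric] by simp
qed

lemma convex_Epi: "convex Epi"
  unfolding convex_alt
proof (intro ballI allI impI)
  fix q q' :: "((real ^ 'n) ^ ('v \<times> 'v \<times> 'v)) \<times> real" and \<theta> :: real
  assume "q \<in> Epi" "q' \<in> Epi" and \<theta>: "0 \<le> \<theta> \<and> \<theta> \<le> 1"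
  then have "(fst q, snd q) \<in> Epi" "(fst q', snd q') \<in> Epi" by simp_all
  then obtain x \<tau> x' \<tau>' where
    x: "\<And>i. i \<in> active \<Longrightarrow> x i \<in> families (nb i)" "\<And>i. i \<in> active \<Longrightarrow> f i (x i) \<le> ereal (\<tau> i)"
      "fst q = stack E x" "(\<Sum>i\<in>active. \<tau> i) \<le> \<rho> * snd q" and
    x': "\<And>i. i \<in> active \<Longrightarrow> x' i \<in> families (nb i)" "\<And>i. i \<in> active \<Longrightarrow> f i (x' i) \<le> ereal (\<tau>' i)"
      "fst q' = stack E x'" "(\<Sum>i\<in>active. \<tau>' i) \<le> \<rho> * snd q'"
    by (elim EpiE) (rule that)
  define y where "y i = (\<lambda>j\<in>nb i. (1 - \<theta>) *\<^sub>R x i j + \<theta> *\<^sub>R x' i j)" for i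
  define \<sigma> where "\<sigma> i = (1 - \<theta>) * \<tau> i + \<theta> * \<tau>' i" for i
  have "f i (y i) \<le> ereal (\<sigma> i)" if "i \<in> active" for i
    unfolding y_def \<sigma>_def using that \<theta> by (intro convex_function_le convex_f x x') auto
  moreover have "y i \<in> families (nb i)" for i by (simp add: y_def)
  moreover have comb: "(1 - \<theta>) *\<^sub>R stack E x + \<theta> *\<^sub>R stack E x' = stack E y"
    by (rule triple_vec_eqI) (simp add: y_def relevant_nb)
  moreover have "(\<Sum>i\<in>active. \<sigma> i) \<le> \<rho> * ((1 - \<theta>) * snd q + \<theta> * snd q')"
  proof -
    have "(\<Sum>i\<in>active. \<sigma> i) = (1 - \<theta>) * (\<Sum>i\<in>active. \<tau> i) + \<theta> * (\<Sum>i\<in>active. \<tau>' i)"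
      by (simp add: \<sigma>_def sum.distrib sum_distrib_left)
    also have "\<dots> \<le> (1 - \<theta>) * (\<rho> * snd q) + \<theta> * (\<rho> * snd q')"
      using \<theta> by (intro add_mono mult_left_mono x x') auto
    finally show ?thesis by (simp add: algebra_simps)
  qed
  ultimately have "(stack E y, (1 - \<theta>) * snd q + \<theta> * snd q') \<in> Epi"
    by (intro EpiI)
  then show "(1 - \<theta>) *\<^sub>R q + \<theta> *\<^sub>R q' \<in> Epi"
    unfolding comb[symmetric] x(3)[symmetric] x'(3)[symmetric]
    by (simp add: scaleR_prod_def plus_prod_def)
qed

lemma edge_consensus_problem: "consensus_problem swap_edges Epi wstar pstar"
proof (rule consensus_problem.intro)
  show "linear swap_edges" by (rule linear_swap_edges)
  show "swap_edges (swap_edges x) = x" for x :: "(real ^ 'n) ^ ('v \<times> 'v \<times> 'v)"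
    by (rule swap_edges_swap_edges)
  show "swap_edges x \<bullet> y = x \<bullet> swap_edges y" for x y :: "(real ^ 'n) ^ ('v \<times> 'v \<times> 'v)"
    by (rule swap_edges_inner)
  show "closed Epi" "convex Epi" by (rule closed_Epi convex_Epi)+
  show "(u, t') \<in> Epi" if "(u, t) \<in> Epi" "t \<le> t'" for u t t'
  proof -
    have "\<rho> * t \<le> \<rho> * t'" using that(2) \<rho>_pos by simp
    with that(1) show ?thesis by (elim EpiE) (use order_trans in \<open>auto intro!: EpiI\<close>)
  qed
  show "(wstar, pstar) \<in> Epi"
    unfolding wstar_def by (rule EpiI[of _ \<phi>]) (use \<rho>_pos in \<open>auto simp: pstar_def f_xs\<close>)
  show "swap_edges wstar = wstar"
    using relevant_nb relevant_swap by (intro triple_vec_eqI) (auto simp: wstar_def)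
  show "pstar \<le> t" if ut: "(u, t) \<in> Epi" and swap: "swap_edges u = u" for u t
  proof -
    obtain x \<tau> where x: "\<And>i. i \<in> active \<Longrightarrow> x i \<in> families (nb i)" "\<And>i. i \<in> active \<Longrightarrow> f i (x i) \<le> ereal (\<tau> i)"
      and u: "u = stack E x" and le: "(\<Sum>i\<in>active. \<tau> i) \<le> \<rho> * t"
      by (rule EpiE[OF ut]) (rule that)
    have "(\<Sum>i\<in>active. \<phi> i) \<le> \<rho> * t"
      using consensus(1)[OF x] le swap unfolding u by linarith
    then show ?thesis using \<rho>_pos by (simp add: pstar_def field_simps)
  qed
  show "u = wstar" if ut: "(u, pstar) \<in> Epi" and swap: "swap_edges u = u" for u
  proof -
    obtain x \<tau> where x: "\<And>i. i \<in> active \<Longrightarrow> x i \<in> families (nb i)" "\<And>i. i \<in> active \<Longrightarrow> f i (x i) \<le> ereal (\<tau> i)"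
      and u: "u = stack E x" and le: "(\<Sum>i\<in>active. \<tau> i) \<le> \<rho> * pstar"
      by (rule EpiE[OF ut]) (rule that)
    have "(\<Sum>i\<in>active. \<tau> i) \<le> (\<Sum>i\<in>active. \<phi> i)" using le \<rho>_pos by (simp add: pstar_def)
    with swap show ?thesis unfolding u by (intro consensus(2)[OF x])
  qed
qed

sublocale consensus_problem swap_edges Epi wstar pstar
  by (rule edge_consensus_problem)

text \<open>
  Completing the squares turns the local objective into \<open>f i\<close> plus a multiple of the squared distance of the
  local copies from the scaled auxiliary variables, up to a constant.
\<close>
definition sq_dist :: "('v, 'n) aux \<Rightarrow> 'v \<Rightarrow> ('v \<Rightarrow> real ^ 'n) \<Rightarrow> real" where
  "sq_dist z i y = (\<Sum>j\<in>neighbors E i. (norm (y i - (1/\<rho>) *\<^sub>R z i j i))\<^sup>2 + (norm (y j - (1/\<rho>) *\<^sub>R z j j i))\<^sup>2)"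

definition sq_offset :: "('v, 'n) aux \<Rightarrow> 'v \<Rightarrow> real" where
  "sq_offset z i = (\<Sum>j\<in>neighbors E i. (norm (z i j i))\<^sup>2 + (norm (z j j i))\<^sup>2) / (2 * \<rho>)"

definition scaled :: "('v, 'n) aux \<Rightarrow> (real ^ 'n) ^ ('v \<times> 'v \<times> 'v)" where
  "scaled z = edge_vec E (\<lambda>c j i. (1/\<rho>) *\<^sub>R z c j i)"

lemma local_objective_eq: "local_objective E f \<rho> z i y = f i y + ereal (\<rho> / 2 * sq_dist z i y - sq_offset z i)"
proof -
  have square: "\<rho> / 2 * (norm (a - (1/\<rho>) *\<^sub>R b))\<^sup>2 = \<rho> / 2 * (norm a)\<^sup>2 - b \<bullet> a + (norm b)\<^sup>2 / (2 * \<rho>)" for a b :: "real ^ 'n"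
    using \<rho>_pos by (simp add: power2_norm_eq_inner inner_simps inner_commute field_simps)
  have "\<rho> / 2 * sq_dist z i y - sq_offset z i =
     (\<Sum>j\<in>neighbors E i. \<rho> / 2 * (norm (y i))\<^sup>2 - z i j i \<bullet> y i + (\<rho> / 2 * (norm (y j))\<^sup>2 - z j j i \<bullet> y j))"
    unfolding sq_dist_def sq_offset_def sum_distrib_left sum_divide_distrib sum_subtractf[symmetric] distrib_left square
    by (rule sum.cong) (simp_all add: add_divide_distrib)
  also have "\<dots> = - ((\<Sum>j\<in>neighbors E i. z i j i) \<bullet> y i) - (\<Sum>j\<in>neighbors E i. z j j i \<bullet> y j)
        + \<rho> / 2 * real (card (neighbors E i)) * (norm (y i))\<^sup>2
        + \<rho> / 2 * (\<Sum>j\<in>neighbors E i. (norm (y j))\<^sup>2)"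
    by (simp add: sum.distrib sum_subtractf inner_sum_left sum_distrib_left)
  finally show ?thesis by (simp add: local_objective_def)
qed

lemma norm_stack_diff: "(norm (stack E x - scaled z))\<^sup>2 = (\<Sum>i\<in>active. sq_dist z i (x i))"
proof -
  have "stack E x - scaled z = edge_vec E (\<lambda>c j i. x i c - (1/\<rho>) *\<^sub>R z c j i)"
    by (rule triple_vec_eqI) (simp add: scaled_def)
  then have "(norm (stack E x - scaled z))\<^sup>2 = (\<Sum>i\<in>UNIV. sq_dist z i (x i))"
    by (simp only: norm_edge_vec[OF irrefl_E] sq_dist_def)
  also have "\<dots> = (\<Sum>i\<in>active. sq_dist z i (x i))"
    by (rule sum.mono_neutral_right) (auto simp: sq_dist_def active_def)
  finally show ?thesis .
qed

text \<open>
  The proximal objective is the sum of the local objectives up to scaling and constants, so the blocks of a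
  proximal point minimize the local objectives. Hence local minimizers exist, the choice made in the
  primal update is one of them, and conversely local minimizers together form a proximal point.
\<close>
lemma primal_update_is_prox: "\<exists>r. is_prox (scaled z) (stack E (primal_update E f \<rho> z)) r"
proof -
  obtain w r0 where prox: "is_prox (scaled z) w r0" using prox_exists by blast
  then have "(w, r0) \<in> Epi" by (simp add: is_prox_def)
  then obtain x0 \<tau>0 where x0: "\<And>i. i \<in> active \<Longrightarrow> x0 i \<in> families (nb i)"
    "\<And>i. i \<in> active \<Longrightarrow> f i (x0 i) \<le> ereal (\<tau>0 i)" and w: "w = stack E x0"
    and r0: "(\<Sum>i\<in>active. \<tau>0 i) \<le> \<rho> * r0"
    by (rule EpiE) (rule that)
  have min: "(\<Sum>i\<in>active. \<tau>0 i + \<rho> / 2 * sq_dist z i (x0 i)) \<le> \<rho> * (t + (norm (u - scaled z))\<^sup>2 / 2)"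
    if ut: "(u, t) \<in> Epi" for u t
  proof -
    have "(\<Sum>i\<in>active. \<tau>0 i + \<rho> / 2 * sq_dist z i (x0 i)) \<le> \<rho> * (r0 + (norm (w - scaled z))\<^sup>2 / 2)"
      using r0 by (simp add: w norm_stack_diff sum.distrib sum_distrib_left sum_divide_distrib distrib_left)
    also have "\<dots> \<le> \<rho> * (t + (norm (u - scaled z))\<^sup>2 / 2)"
      using prox ut \<rho>_pos unfolding is_prox_def by (intro mult_left_mono) auto
    finally show ?thesis .
  qed
  have min_sum: "(\<Sum>i\<in>active. \<tau>0 i + \<rho> / 2 * sq_dist z i (x0 i)) \<le> (\<Sum>i\<in>active. \<tau> i + \<rho> / 2 * sq_dist z i (x i))"
    if "\<And>i. i \<in> active \<Longrightarrow> x i \<in> families (nb i)" "\<And>i. i \<in> active \<Longrightarrow> f i (x i) \<le> ereal (\<tau> i)" for x \<tau>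
  proof -
    have "(stack E x, (\<Sum>i\<in>active. \<tau> i) / \<rho>) \<in> Epi"
      using that \<rho>_pos by (intro EpiI[of _ \<tau>]) auto
    from min[OF this] show ?thesis
      using \<rho>_pos by (simp add: norm_stack_diff sum.distrib sum_distrib_left sum_divide_distrib distrib_left)
  qed
  have argmin: "is_arg_min (local_objective E f \<rho> z i) (\<lambda>y. y \<in> families (nb i)) (x0 i)" if i: "i \<in> active" for i
    unfolding is_arg_min_def
  proof (intro conjI notI)
    show "x0 i \<in> families (nb i)" by (rule x0(1)[OF i])
    assume "\<exists>y. y \<in> families (nb i) \<and> local_objective E f \<rho> z i y < local_objective E f \<rho> z i (x0 i)"
    then obtain y where y: "y \<in> families (nb i)"
      and less: "f i y + ereal (\<rho> / 2 * sq_dist z i y - sq_offset z i) < f i (x0 i) + ereal (\<rho> / 2 * sq_dist z i (x0 i) - sq_offset z i)"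
      unfolding local_objective_eq by blast
    note less
    also have "f i (x0 i) + ereal (\<rho> / 2 * sq_dist z i (x0 i) - sq_offset z i) \<le> ereal (\<tau>0 i) + ereal (\<rho> / 2 * sq_dist z i (x0 i) - sq_offset z i)"
      by (intro add_mono x0(2)[OF i]) simp
    finally have lt: "f i y + ereal (\<rho> / 2 * sq_dist z i y - sq_offset z i) < ereal (\<tau>0 i + \<rho> / 2 * sq_dist z i (x0 i) - sq_offset z i)"
      by (simp add: add_diff_eq)
    then obtain b where b: "f i y = ereal b"
      using f_not_minf[OF y] by (cases "f i y") auto
    have "(\<Sum>j\<in>active. \<tau>0 j + \<rho> / 2 * sq_dist z j (x0 j))
      \<le> (\<Sum>j\<in>active. (\<tau>0(i := b)) j + \<rho> / 2 * sq_dist z j ((x0(i := y)) j))"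
      by (rule min_sum) (use x0 y b in auto)
    then have "\<tau>0 i + \<rho> / 2 * sq_dist z i (x0 i) \<le> b + \<rho> / 2 * sq_dist z i y"
      using i by (simp add: sum.remove[of active i])
    then show False using lt by (simp add: b)
  qed
  define x where "x = primal_update E f \<rho> z"
  have x: "is_arg_min (local_objective E f \<rho> z i) (\<lambda>y. y \<in> families (nb i)) (x i)" if "i \<in> active" for i
    unfolding x_def primal_update_def by (rule is_arg_min_arg_min[OF argmin[OF that]])
  have "\<exists>\<tau>. x i \<in> families (nb i) \<and> f i (x i) \<le> ereal \<tau> \<and> \<tau> + \<rho> / 2 * sq_dist z i (x i) \<le> \<tau>0 i + \<rho> / 2 * sq_dist z i (x0 i)"
    if i: "i \<in> active" for i
  proof -
    have mem: "x i \<in> families (nb i)" using x[OF i] by (simp add: is_arg_min_def)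
    have "f i (x i) + ereal (\<rho> / 2 * sq_dist z i (x i) - sq_offset z i) \<le> f i (x0 i) + ereal (\<rho> / 2 * sq_dist z i (x0 i) - sq_offset z i)"
      using x[OF i] x0(1)[OF i] unfolding is_arg_min_def local_objective_eq by (meson not_less)
    also have "\<dots> \<le> ereal (\<tau>0 i) + ereal (\<rho> / 2 * sq_dist z i (x0 i) - sq_offset z i)"
      by (intro add_mono x0(2)[OF i]) simp
    finally have "f i (x i) + ereal (\<rho> / 2 * sq_dist z i (x i) - sq_offset z i) \<le> ereal (\<tau>0 i + \<rho> / 2 * sq_dist z i (x0 i) - sq_offset z i)"
      by (simp add: add_diff_eq)
    then show ?thesis using mem f_not_minf[OF mem] by (cases "f i (x i)") auto
  qed
  then obtain \<tau> where \<tau>: "\<And>i. i \<in> active \<Longrightarrow> x i \<in> families (nb i) \<and> f i (x i) \<le> ereal (\<tau> i)"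
    and le: "\<And>i. i \<in> active \<Longrightarrow> \<tau> i + \<rho> / 2 * sq_dist z i (x i) \<le> \<tau>0 i + \<rho> / 2 * sq_dist z i (x0 i)"
    by metis
  define r where "r = (\<Sum>i\<in>active. \<tau> i) / \<rho>"
  have "(stack E x, r) \<in> Epi" unfolding r_def using \<tau> \<rho>_pos by (intro EpiI[of _ \<tau>]) auto
  moreover have "r + (norm (stack E x - scaled z))\<^sup>2 / 2 \<le> t + (norm (u - scaled z))\<^sup>2 / 2"
    if "(u, t) \<in> Epi" for u t
  proof -
    have "\<rho> * (r + (norm (stack E x - scaled z))\<^sup>2 / 2) = (\<Sum>i\<in>active. \<tau> i + \<rho> / 2 * sq_dist z i (x i))"
      using \<rho>_pos by (simp add: r_def norm_stack_diff sum.distrib sum_distrib_left sum_divide_distrib distrib_left)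
    also have "\<dots> \<le> (\<Sum>i\<in>active. \<tau>0 i + \<rho> / 2 * sq_dist z i (x0 i))" by (intro sum_mono le)
    also have "\<dots> \<le> \<rho> * (t + (norm (u - scaled z))\<^sup>2 / 2)" by (rule min[OF that])
    finally show ?thesis using \<rho>_pos by simp
  qed
  ultimately show ?thesis unfolding is_prox_def x_def by blast
qed

lemma scaled_aux_update:
  "scaled (aux_update E f \<alpha> \<rho> z)
    = (1 - \<alpha>) *\<^sub>R scaled z + \<alpha> *\<^sub>R swap_edges (2 *\<^sub>R stack E (primal_update E f \<rho> z) - scaled z)"
  using \<rho>_pos
  by (intro triple_vec_eqI)
    (simp add: scaled_def aux_update_def message_def relevant_swap algebra_simps)

lemma active_convergence:
  assumes "0 < \<alpha>" "\<alpha> < 1" and "relevant E c j i"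
  shows "(\<lambda>k. radmm_primal E f \<alpha> \<rho> z0 k i c) \<longlonglongrightarrow> xs c"
proof -
  define s where "s k = scaled (radmm_aux E f \<alpha> \<rho> z0 k)" for k
  define w where "w k = stack E (radmm_primal E f \<alpha> \<rho> z0 k)" for k
  have w: "w k = stack E (primal_update E f \<rho> (radmm_aux E f \<alpha> \<rho> z0 k))" for k
    unfolding w_def by (rule arg_cong[where f = "stack E"], rule ext) (simp add: radmm_primal_def)
  have "\<forall>k. \<exists>r. is_prox (s k) (w k) r" unfolding s_def w using primal_update_is_prox by blast
  then obtain r where r: "\<And>k. is_prox (s k) (w k) (r k)" by metis
  interpret relaxed_splitting swap_edges Epi wstar pstar \<alpha> s w r
    by unfold_locales (use assms r in \<open>simp_all add: s_def w scaled_aux_update\<close>)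
  have "(\<lambda>k. w k $ (c, j, i)) \<longlonglongrightarrow> wstar $ (c, j, i)"
    by (intro tendsto_vec_nth primal_convergence)
  then show ?thesis using assms(3) by (simp add: w_def wstar_def relevant_nb)
qed

text \<open>
  The local objective of an isolated node is its cost function. Exchanging its component of the optimal
  solution for a minimizer affects no other node, so uniqueness determines that minimizer.
\<close>
lemma isolated_update:
  assumes "i \<notin> active"
  shows "primal_update E f \<rho> z i i = xs i"
proof -
  have N: "neighbors E i = {}" and nb: "nb i = {i}" using assms by (auto simp: active_def closed_nbhd_def)
  have loc: "local_objective E f \<rho> z i = f i" by (rule ext) (simp add: local_objective_def N zero_ereal_def[symmetric])
  have other: "i \<notin> nb j" if "j \<noteq> i" for j
    using that N sym_E by (auto simp: closed_nbhd_def neighbors_def sym_def)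
  have cost: "\<phi> i \<le> b" "b \<le> \<phi> i \<Longrightarrow> y i = xs i" if y: "y \<in> families {i}" and b: "f i y = ereal b" for y b
  proof -
    have "restrict (xs(i := y i)) (nb i) = y"
      using y by (auto simp: nb PiE_def extensional_def fun_eq_iff)
    moreover have "restrict (xs(i := y i)) (nb j) = restrict xs (nb j)" if "j \<noteq> i" for j
      using other[OF that] by (auto simp: fun_eq_iff)
    ultimately have le: "f j (restrict (xs(i := y i)) (nb j)) \<le> ereal ((\<phi>(i := b)) j)" for j
      using b f_xs[of j] by (cases "j = i") auto
    have sums: "(\<Sum>j\<in>UNIV. (\<phi>(i := b)) j) = b + (\<Sum>j\<in>UNIV - {i}. \<phi> j)"
      "(\<Sum>j\<in>UNIV. \<phi> j) = \<phi> i + (\<Sum>j\<in>UNIV - {i}. \<phi> j)"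
      by (simp_all add: sum.remove[of UNIV i])
    show "\<phi> i \<le> b" using optimality(1)[OF le] unfolding sums by simp
    show "y i = xs i" if "b \<le> \<phi> i"
    proof -
      have "xs(i := y i) = xs" using optimality(2)[OF le] that unfolding sums by simp
      then show ?thesis by (metis fun_upd_same)
    qed
  qed
  have fx: "f i (restrict xs {i}) = ereal (\<phi> i)" using f_xs[of i] by (simp add: nb)
  have "is_arg_min (f i) (\<lambda>y. y \<in> families {i}) (restrict xs {i})"
    unfolding is_arg_min_def
  proof (intro conjI notI)
    assume "\<exists>y. y \<in> families {i} \<and> f i y < f i (restrict xs {i})"
    then obtain y where y: "y \<in> families {i}" "f i y < ereal (\<phi> i)" unfolding fx by blast
    then obtain b where "f i y = ereal b" using f_not_minf[of y i] by (cases "f i y") (auto simp: nb)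
    then show False using cost(1)[OF y(1)] y(2) by force
  qed simp
  then have min: "is_arg_min (f i) (\<lambda>y. y \<in> families {i}) (primal_update E f \<rho> z i)"
    unfolding primal_update_def loc nb by (rule is_arg_min_arg_min)
  define y where "y = primal_update E f \<rho> z i"
  have y: "y \<in> families {i}" using min by (simp add: is_arg_min_def y_def)
  have "f i y \<le> ereal (\<phi> i)"
    using min fx unfolding is_arg_min_def y_def by (metis (no_types, lifting) not_less restrict_PiE_iff UNIV_I)
  then obtain b where "f i y = ereal b" "b \<le> \<phi> i" using f_not_minf[of y i] y by (cases "f i y") (auto simp: nb)
  then show ?thesis using cost(2)[OF y] by (simp add: y_def)
qed

end

theorem proposition2:
  fixes E :: "('v::finite \<times> 'v) set"
    and f :: "'v \<Rightarrow> ('v \<Rightarrow> real ^ 'n) \<Rightarrow> ereal"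
    and xs :: "'v \<Rightarrow> real ^ 'n"
    and z0 :: "('v, 'n) aux"
    and \<alpha> \<rho> :: real
  assumes "sym E" and "irrefl E"
    and "\<And>i. closed_function (closed_nbhd E i) (f i)"
    and "\<And>i. proper_function (closed_nbhd E i) (f i)"
    and "\<And>i. convex_function (closed_nbhd E i) (f i)"
    and "optimal_solution E f xs"
    and "\<And>y. optimal_solution E f y \<Longrightarrow> y = xs"
    and "0 < \<alpha>" and "\<alpha> < 1" and "0 < \<rho>"
  shows "\<forall>i. (\<lambda>k. radmm_primal E f \<alpha> \<rho> z0 k i i) \<longlonglongrightarrow> xs i \<and>
           (\<forall>j\<in>neighbors E i. (\<lambda>k. radmm_primal E f \<alpha> \<rho> z0 k i j) \<longlonglongrightarrow> xs j)"
proof -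
  interpret partitioned_problem E f xs \<rho>
    using assms by unfold_locales
  show ?thesis
  proof (intro allI conjI ballI)
    fix i j assume "j \<in> neighbors E i"
    then have "relevant E j j i" by (simp add: relevant_def neighbors_def)
    then show "(\<lambda>k. radmm_primal E f \<alpha> \<rho> z0 k i j) \<longlonglongrightarrow> xs j"
      by (rule active_convergence[OF assms(8,9)])
  next
    fix i
    show "(\<lambda>k. radmm_primal E f \<alpha> \<rho> z0 k i i) \<longlonglongrightarrow> xs i"
    proof (cases "i \<in> active")
      case True
      then obtain j where "relevant E i j i" by (auto simp: active_def relevant_def neighbors_def)
      then show ?thesis by (rule active_convergence[OF assms(8,9)])
    next
      case False
      then show ?thesis by (simp add: radmm_primal_def isolated_update)
    qed
  qed
qed

end
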